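(* Let $m,n$ be coprime positive integers and $G=\langle x,y\mid x^m=y^n\rangle$. Let $Y$ be the set of characters of $SU(2)$-representations of $G$, regarded inside the $SL(2,\mathbb{C})$-character variety of $G$, and let $Y_{red},Y_{irr}\subset Y$ be the subsets of characters of reducible, respectively irreducible, $SU(2)$-representations. Then $Y$ is topologically a closed interval ($Y_{red}$) with $\frac{(m-1)(n-1)}{2}$ open intervals ($Y_{irr}$) attached at $(m-1)(n-1)$ different points of $Y_{red}$, without any intersections among them: that is, $Y_{red}$ is homeomorphic to a closed interval, $Y_{irr}$ is a disjoint union of $\frac{(m-1)(n-1)}{2}$ open intervals, the closure of each of these open intervals is obtained by adding two distinct endpoints lying in $Y_{red}$, and the $(m-1)(n-1)$ endpoints obtained in this way are pairwise different.
   Context: An $SU(2)$-representation of $G$ is a homomorphism $\rho:G\to SU(2)$, regarded also as an $SL(2,\mathbb{C})$-representation via $SU(2)\subset SL(2,\mathbb{C})$. It is reducible if the matrices $\rho(g)$, $g\in G$, have a common eigenvector in $\mathbb{C}^2$, and irreducible otherwise. The character of $\rho$ is $\chi_\rho:G\to\mathbb{C}$, $\chi_\rho(g)=\operatorname{tr}\rho(g)$. The character variety $X_{SL(2,\mathbb{C})}(G)\subset\mathbb{C}^G$ is the set of characters of all homomorphisms $G\to SL(2,\mathbb{C})$, with the topology of pointwise convergence of characters; $Y$ and its subsets carry the subspace topology. *)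

theory Defs
  imports "HOL-Analysis.Analysis" "HOL-Algebra.Group"
begin

text \<open>
  Group presentations. The generators are all elements of the type \<open>'a\<close>; the letter
  \<open>(a, True)\<close> stands for \<open>a\<close> and \<open>(a, False)\<close> for its inverse, and a pair
  \<open>(u, v)\<close> of words in \<open>R\<close> is the relation \<open>u = v\<close>.
\<close>

type_synonym 'a word = "('a \<times> bool) list"

inductive word_eq :: "('a word \<times> 'a word) set \<Rightarrow> 'a word \<Rightarrow> 'a word \<Rightarrow> bool"
  for R :: "('a word \<times> 'a word) set" where
  refl: "word_eq R u u"
| sym: "word_eq R u v \<Longrightarrow> word_eq R v u"
| trans: "word_eq R u v \<Longrightarrow> word_eq R v w \<Longrightarrow> word_eq R u w"
| append: "word_eq R u u' \<Longrightarrow> word_eq R v v' \<Longrightarrow> word_eq R (u @ v) (u' @ v')"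
| cancel: "word_eq R [(a, b), (a, \<not> b)] []"
| rel: "(u, v) \<in> R \<Longrightarrow> word_eq R u v"

definition word_class :: "('a word \<times> 'a word) set \<Rightarrow> 'a word \<Rightarrow> 'a word set" where
  "word_class R u = {v. word_eq R u v}"

definition presented_group :: "('a word \<times> 'a word) set \<Rightarrow> 'a word set monoid" where
  "presented_group R =
     \<lparr>carrier = range (word_class R),
      mult = (\<lambda>A B. \<Union>u\<in>A. \<Union>v\<in>B. word_class R (u @ v)),
      one = word_class R []\<rparr>"

lemma word_class_eq_iff: "word_class R u = word_class R v \<longleftrightarrow> word_eq R u v"
proof
  assume "word_class R u = word_class R v"
  then have "v \<in> word_class R u"
    by (simp add: word_class_def word_eq.refl)
  then show "word_eq R u v"
    by (simp add: word_class_def)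
next
  assume "word_eq R u v"
  then show "word_class R u = word_class R v"
    unfolding word_class_def by (blast intro: word_eq.sym word_eq.trans)
qed

lemma mult_word_class:
  "word_class R u \<otimes>\<^bsub>presented_group R\<^esub> word_class R v = word_class R (u @ v)"
proof -
  have "word_class R (u' @ v') = word_class R (u @ v)"
    if "u' \<in> word_class R u" "v' \<in> word_class R v" for u' v'
    using word_eq.sym[OF word_eq.append[of R u u' v v']] that
    unfolding word_class_eq_iff by (simp add: word_class_def)
  then have "(\<Union>u'\<in>word_class R u. \<Union>v'\<in>word_class R v. word_class R (u' @ v'))
      = (\<Union>u'\<in>word_class R u. \<Union>v'\<in>word_class R v. word_class R (u @ v))"
    by (intro SUP_cong HOL.refl)
  moreover have "u \<in> word_class R u" "v \<in> word_class R v"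
    by (simp_all add: word_class_def word_eq.refl)
  ultimately show ?thesis
    unfolding presented_group_def by auto
qed

lemma word_left_inverse:
  "word_eq R (rev (map (\<lambda>(a, b). (a, \<not> b)) u) @ u) []"
proof (induction u)
  case Nil
  show ?case by (simp add: word_eq.refl)
next
  case (Cons l u)
  obtain a b where l: "l = (a, b)" by (cases l)
  let ?w = "rev (map (\<lambda>(a, b). (a, \<not> b)) u)"
  have "word_eq R [(a, \<not> b), (a, b)] []"
    using word_eq.cancel[of R a "\<not> b"] by simp
  then have "word_eq R (?w @ ([(a, \<not> b), (a, b)] @ u)) (?w @ ([] @ u))"
    by (intro word_eq.append word_eq.refl)
  then show ?case
    using word_eq.trans[OF _ Cons] by (simp add: l)
qed

lemma group_presented_group: "group (presented_group R)"
proof (rule groupI)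
  fix A assume "A \<in> carrier (presented_group R)"
  then obtain u where u: "A = word_class R u"
    by (auto simp: presented_group_def)
  let ?w = "rev (map (\<lambda>(a, b). (a, \<not> b)) u)"
  have "word_class R ?w \<otimes>\<^bsub>presented_group R\<^esub> A = \<one>\<^bsub>presented_group R\<^esub>"
    unfolding u mult_word_class
    by (simp add: presented_group_def word_class_eq_iff word_left_inverse)
  then show "\<exists>B\<in>carrier (presented_group R). B \<otimes>\<^bsub>presented_group R\<^esub> A = \<one>\<^bsub>presented_group R\<^esub>"
    by (auto simp: presented_group_def)
next
  have car: "carrier (presented_group R) = range (word_class R)"
    and one: "\<one>\<^bsub>presented_group R\<^esub> = word_class R []"
    by (auto simp: presented_group_def)
  show "\<one>\<^bsub>presented_group R\<^esub> \<in> carrier (presented_group R)"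
    by (simp add: car one)
  show "A \<otimes>\<^bsub>presented_group R\<^esub> B \<in> carrier (presented_group R)"
    if "A \<in> carrier (presented_group R)" "B \<in> carrier (presented_group R)" for A B
    using that by (auto simp: car mult_word_class)
  show "A \<otimes>\<^bsub>presented_group R\<^esub> B \<otimes>\<^bsub>presented_group R\<^esub> C
      = A \<otimes>\<^bsub>presented_group R\<^esub> (B \<otimes>\<^bsub>presented_group R\<^esub> C)"
    if "A \<in> carrier (presented_group R)" "B \<in> carrier (presented_group R)"
      "C \<in> carrier (presented_group R)" for A B C
    using that by (auto simp: car mult_word_class)
  show "\<one>\<^bsub>presented_group R\<^esub> \<otimes>\<^bsub>presented_group R\<^esub> A = A"
    if "A \<in> carrier (presented_group R)" for A
    using that by (auto simp: car one mult_word_class)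
qed

datatype xy = gen_x | gen_y

definition torus_knot_group :: "nat \<Rightarrow> nat \<Rightarrow> xy word set monoid" where
  "torus_knot_group m n =
     presented_group {(replicate m (gen_x, True), replicate n (gen_y, True))}"

definition SL2 :: "(complex^2^2) monoid" where
  "SL2 = \<lparr>carrier = {A. det A = 1}, mult = (**), one = mat 1\<rparr>"

definition conj_transpose :: "complex^2^2 \<Rightarrow> complex^2^2" where
  "conj_transpose A = (\<chi> i j. cnj (A $ j $ i))"

definition SU2 :: "(complex^2^2) monoid" where
  "SU2 = SL2\<lparr>carrier := {A. det A = 1 \<and> A ** conj_transpose A = mat 1}\<rparr>"

definition reducible :: "('g, 'b) monoid_scheme \<Rightarrow> ('g \<Rightarrow> complex^2^2) \<Rightarrow> bool" where
  "reducible G \<rho> \<longleftrightarrow> (\<exists>v. v \<noteq> 0 \<and> (\<forall>g\<in>carrier G. \<exists>c. \<rho> g *v v = c *s v))"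

text \<open>
  Characters are made extensional (\<open>undefined\<close> outside the carrier), so that they are points of
  the product space over \<open>carrier G\<close>.
\<close>

definition rep_character :: "('g, 'b) monoid_scheme \<Rightarrow> ('g \<Rightarrow> complex^2^2) \<Rightarrow> 'g \<Rightarrow> complex" where
  "rep_character G \<rho> = restrict (\<lambda>g. trace (\<rho> g)) (carrier G)"

definition SL2_character_variety :: "('g, 'b) monoid_scheme \<Rightarrow> ('g \<Rightarrow> complex) set" where
  "SL2_character_variety G = rep_character G ` hom G SL2"

definition character_topology :: "('g, 'b) monoid_scheme \<Rightarrow> ('g \<Rightarrow> complex) topology" where
  "character_topology G =
     subtopology (product_topology (\<lambda>_. euclidean) (carrier G)) (SL2_character_variety G)"

definition SU2_characters :: "('g, 'b) monoid_scheme \<Rightarrow> ('g \<Rightarrow> complex) set" where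
  "SU2_characters G = rep_character G ` hom G SU2"

definition SU2_characters_red :: "('g, 'b) monoid_scheme \<Rightarrow> ('g \<Rightarrow> complex) set" where
  "SU2_characters_red G = rep_character G ` {\<rho> \<in> hom G SU2. reducible G \<rho>}"

definition SU2_characters_irr :: "('g, 'b) monoid_scheme \<Rightarrow> ('g \<Rightarrow> complex) set" where
  "SU2_characters_irr G = rep_character G ` {\<rho> \<in> hom G SU2. \<not> reducible G \<rho>}"

end

(* A representation is a pair A, B in SU(2) with A^m = B^n, and its character depends only on
   tr A, tr B and tr AB (Fricke). A common eigenvector forces
   (tr A)^2 + (tr B)^2 + (tr AB)^2 - tr A tr B tr AB = 4, so the character sees reducibility.
   Reducible pairs are diag(w^n, w^-n), diag(w^m, w^-m) with w = exp(i theta), theta in [0, pi].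
   In an irreducible pair A^m = B^n commutes with both matrices, hence is a sign; then
   tr A = 2 cos(k pi/m) and tr B = 2 cos(l pi/n) with 0 < k < m, 0 < l < n and k = l mod 2, and the
   only remaining parameter is the angle phi in (0, pi) between the rotation axes of A and B. At
   phi = 0 and phi = pi the pair becomes reducible; the three traces tell apart all (k, l, phi) with
   phi in [0, pi], so the closed arcs are disjoint embedded intervals. *)
theory Submission
  imports Defs
begin

section \<open>Pairs of matrices and their words\<close>

text \<open>No representation is conjugated to a normal form. A given pair is replaced by a standard
  pair of \<open>rot\<close> matrices with the same three traces, and
  \<open>word_eval_cong_traces\<close> makes the characters agree. Centrality of the common power is
  computed: A^m and B^n are linear in A and in B, so a nonzero coefficient in A^m = B^n would make
  one matrix a polynomial in the other; they would commute and share an eigenvector. Coprimality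
  enters three times: the eigenvalues of a reducible pair are powers of one number on the unit
  circle, a word with Bezout exponents recovers \<theta>, and one of \<open>m\<close>,
  \<open>n\<close> is odd, which balances the parity classes in the count. For the topology only
  continuity and injectivity on a closed interval are checked; compactness against a Hausdorff
  target gives the embeddings, and finiteness of the family makes each arc open in the irreducible
  part.\<close>

lemmas mat2_simps = vec_eq_iff forall_2 sum_2 matrix_matrix_mult_def matrix_vector_mult_def
  mat_def trace_def det_2 conj_transpose_def

lemma trace_2: "trace (A :: 'a::comm_ring_1^2^2) = A$1$1 + A$2$2"
  by (simp add: trace_def sum_2)

text \<open>The adjugate, which inverts matrices of determinant 1. In this linear form it is total,
  keeps the eigenvectors of \<open>A\<close> and is continuous in the entries.\<close>

definition adj2 :: "complex^2^2 \<Rightarrow> complex^2^2" where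
  "adj2 A = mat (trace A) - A"

lemma adj2_entries:
  "adj2 A $ 1 $ 1 = A$2$2" "adj2 A $ 2 $ 2 = A$1$1" "adj2 A $ 1 $ 2 = - A$1$2" "adj2 A $ 2 $ 1 = - A$2$1"
  by (auto simp: adj2_def mat_def trace_2)

lemma adj2_mult: "det A = 1 \<Longrightarrow> adj2 A ** A = mat 1"
  by (simp add: adj2_entries mat2_simps algebra_simps)

lemma mult_adj2: "det A = 1 \<Longrightarrow> A ** adj2 A = mat 1"
  by (simp add: adj2_entries mat2_simps algebra_simps)

section \<open>Matrices of SU(2) in coordinates\<close>

lemma SU2_iff:
  "A \<in> carrier SU2 \<longleftrightarrow> A$2$1 = - cnj (A$1$2) \<and> A$2$2 = cnj (A$1$1)
     \<and> A$1$1 * cnj (A$1$1) + A$1$2 * cnj (A$1$2) = 1"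
proof
  assume "A \<in> carrier SU2"
  then have d: "det A = 1" and u: "A ** conj_transpose A = mat 1"
    by (auto simp: SU2_def SL2_def)
  \<comment> \<open>Adjugate and conjugate transpose are both inverse to \<open>A\<close>, so they
    agree entry by entry.\<close>
  have "adj2 A = adj2 A ** (A ** conj_transpose A)"
    by (simp add: u)
  also have "\<dots> = conj_transpose A"
    by (simp add: matrix_mul_assoc adj2_mult d)
  finally have e: "adj2 A = conj_transpose A" .
  have "- (A$2$1) = cnj (A$1$2)" "A$2$2 = cnj (A$1$1)"
    using arg_cong[OF e, of "\<lambda>M. M$2$1"] arg_cong[OF e, of "\<lambda>M. M$1$1"]
    by (simp_all add: adj2_entries conj_transpose_def)
  then have "A$2$1 = - cnj (A$1$2)" "A$2$2 = cnj (A$1$1)"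
    by (metis minus_minus)+
  moreover from this d have "A$1$1 * cnj (A$1$1) + A$1$2 * cnj (A$1$2) = 1"
    by (simp add: det_2)
  ultimately show "A$2$1 = - cnj (A$1$2) \<and> A$2$2 = cnj (A$1$1)
     \<and> A$1$1 * cnj (A$1$1) + A$1$2 * cnj (A$1$2) = 1"
    by simp
next
  assume "A$2$1 = - cnj (A$1$2) \<and> A$2$2 = cnj (A$1$1)
     \<and> A$1$1 * cnj (A$1$1) + A$1$2 * cnj (A$1$2) = 1"
  then show "A \<in> carrier SU2"
    by (simp add: SU2_def SL2_def mat2_simps algebra_simps)
qed

lemma SU2_det: "A \<in> carrier SU2 \<Longrightarrow> det A = 1"
  by (simp add: SU2_def)

lemma SU2_mult_closed:
  assumes "A \<in> carrier SU2" "B \<in> carrier SU2"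
  shows "A ** B \<in> carrier SU2"
proof -
  have c: "conj_transpose (A ** B) = conj_transpose B ** conj_transpose A"
    by (simp add: mat2_simps mult.commute)
  have "A ** B ** conj_transpose (A ** B) = A ** (B ** conj_transpose B) ** conj_transpose A"
    by (simp add: c matrix_mul_assoc)
  also have "\<dots> = mat 1"
    using assms by (simp add: SU2_def)
  finally show ?thesis
    using assms by (simp add: SU2_def det_mul)
qed

lemma SU2_mat1: "mat 1 \<in> carrier SU2"
  by (simp add: SU2_iff mat_def)

lemma SU2_adj2: "A \<in> carrier SU2 \<Longrightarrow> adj2 A \<in> carrier SU2"
  by (simp add: SU2_iff adj2_entries mult.commute)

text \<open>The unit quaternion with real part \<open>cos b\<close> whose imaginary part has length \<open>sin b\<close> and makes
  the angle \<open>\<phi>\<close> with the axis of the diagonal matrices, so that \<open>rot 0 b = diag (e\<^sup>i\<^sup>b, e\<^sup>-\<^sup>i\<^sup>b)\<close>.\<close>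

definition rot :: "real \<Rightarrow> real \<Rightarrow> complex^2^2" where
  "rot \<phi> b = vector [vector [Complex (cos b) (sin b * cos \<phi>), of_real (sin b * sin \<phi>)],
                    vector [- of_real (sin b * sin \<phi>), Complex (cos b) (- (sin b * cos \<phi>))]]"

lemma rot_entries:
  "rot \<phi> b $ 1 $ 1 = Complex (cos b) (sin b * cos \<phi>)" "rot \<phi> b $ 1 $ 2 = of_real (sin b * sin \<phi>)"
  "rot \<phi> b $ 2 $ 1 = - of_real (sin b * sin \<phi>)" "rot \<phi> b $ 2 $ 2 = Complex (cos b) (- (sin b * cos \<phi>))"
  by (simp_all add: rot_def)

text \<open>Fixing \<phi> fixes the rotation axis, so these matrices form a one-parameter group and
  powers become multiples of an angle.\<close>

lemma rot_mult: "rot \<phi> a ** rot \<phi> b = rot \<phi> (a + b)"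
proof -
  \<comment> \<open>Pythagoras with a spare factor, so that rewriting also catches the square inside
    a longer product.\<close>
  have s: "sin \<phi> * (sin \<phi> * z) = z - cos \<phi> * (cos \<phi> * z)" for z
    using sin_cos_squared_add[of \<phi>] by (simp add: power2_eq_square algebra_simps, algebra)
  show ?thesis
    by (simp add: rot_entries mat2_simps complex_eq_iff cos_add sin_add algebra_simps s)
qed

lemma rot_0: "rot \<phi> 0 = mat 1"
  by (simp add: rot_entries mat2_simps complex_eq_iff)

lemma rot_SU2: "rot \<phi> b \<in> carrier SU2"
proof -
  have "(cos b)\<^sup>2 + (sin b)\<^sup>2 * ((sin \<phi>)\<^sup>2 + (cos \<phi>)\<^sup>2) = 1"
    by simp
  then have "cos b * cos b + (cos \<phi> * (cos \<phi> * (sin b * sin b)) + sin \<phi> * (sin \<phi> * (sin b * sin b))) = 1"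
    by (simp only: power2_eq_square algebra_simps)
  then show ?thesis
    by (simp add: rot_entries SU2_iff complex_eq_iff algebra_simps power2_eq_square)
qed

lemma adj2_rot: "adj2 (rot \<phi> b) = rot \<phi> (- b)"
  by (simp add: rot_entries adj2_entries mat2_simps complex_eq_iff)

lemma trace_rot: "trace (rot \<phi> b) = of_real (2 * cos b)"
  by (simp add: rot_entries trace_2 complex_eq_iff)

text \<open>The spherical law of cosines: the real part of a product of unit quaternions is the
  product of the real parts minus the inner product of the imaginary parts.\<close>

lemma trace_rot_mult:
  "trace (rot 0 a ** rot \<phi> b) = of_real (2 * (cos a * cos b - sin a * sin b * cos \<phi>))"
  by (simp add: rot_entries mat2_simps complex_eq_iff algebra_simps)

section \<open>Evaluation of words at a pair of matrices\<close>

primrec letter_eval :: "complex^2^2 \<Rightarrow> complex^2^2 \<Rightarrow> xy \<Rightarrow> complex^2^2" where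
  "letter_eval A B gen_x = A"
| "letter_eval A B gen_y = B"

primrec word_eval :: "complex^2^2 \<Rightarrow> complex^2^2 \<Rightarrow> xy word \<Rightarrow> complex^2^2" where
  "word_eval A B [] = mat 1"
| "word_eval A B (l # w) =
     (if snd l then letter_eval A B (fst l) else adj2 (letter_eval A B (fst l))) ** word_eval A B w"

lemma word_eval_append: "word_eval A B (u @ v) = word_eval A B u ** word_eval A B v"
  by (induction u) (simp_all add: matrix_mul_assoc)

lemma word_eval_SU2:
  assumes "A \<in> carrier SU2" "B \<in> carrier SU2"
  shows "word_eval A B w \<in> carrier SU2"
proof (induction w)
  case (Cons l w)
  then show ?case
    using assms by (cases "fst l") (auto intro!: SU2_mult_closed SU2_adj2)
qed (simp add: SU2_mat1)

lemma word_eval_replicate_rot: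
  "word_eval (rot \<phi> a) B (replicate k (gen_x, True)) = rot \<phi> (k * a)"
  "word_eval A (rot \<phi> a) (replicate k (gen_y, True)) = rot \<phi> (k * a)"
  "word_eval A (rot \<phi> a) (replicate k (gen_y, False)) = rot \<phi> (- (k * a))"
  by (induction k) (simp_all add: rot_0 rot_mult algebra_simps adj2_rot)

text \<open>Fricke: the span of \<open>1, A, B, AB\<close> is stable under left multiplication by \<open>A\<close>, \<open>B\<close> and their
  inverses, with structure constants that are polynomials in the three traces.\<close>

lemma word_eval_cong_traces:
  assumes "det A = 1" "det B = 1" "det A' = 1" "det B' = 1"
    and "trace A' = trace A" "trace B' = trace B" "trace (A' ** B') = trace (A ** B)"
  shows "trace (word_eval A' B' w) = trace (word_eval A B w)"
proof -
  \<comment> \<open>The element of the span with coordinates \<open>c\<close>. The structure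
    constants are found for arbitrary \<open>P\<close>, \<open>Q\<close>, so that both pairs share
    them.\<close>
  define C where "C P Q c = (\<chi> i j. c 0 * mat 1 $ i $ j + c 1 * P $ i $ j + c 2 * Q $ i $ j + c 3 * (P ** Q) $ i $ j)"
    for P Q :: "complex^2^2" and c :: "nat \<Rightarrow> complex"
  define x y z where "x = trace A" "y = trace B" "z = trace (A ** B)"
  have mulA: "P ** C P Q c = C P Q (\<lambda>i. if i = 0 then - c 1 else if i = 1 then c 0 + x * c 1 else if i = 2 then - c 3 else c 2 + x * c 3)"
    if "det P = 1" "trace P = x" for P Q :: "complex^2^2" and c
    using that unfolding C_def by (simp add: mat2_simps) algebra
  \<comment> \<open>Polarised Cayley--Hamilton gives Q P = (z - x y) + y P + x Q - P Q.
    Cayley--Hamilton for P Q gives Q P Q = z Q - P^-1 = P + z Q - x.\<close>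
  have mulB: "Q ** C P Q c = C P Q (\<lambda>i. if i = 0 then (z - x * y) * c 1 - c 2 - x * c 3 
        else if i = 1 then y * c 1 + c 3 else if i = 2 then c 0 + x * c 1 + y * c 2 + z * c 3 else - c 1)"
    if "det P = 1" "trace P = x" "det Q = 1" "trace Q = y" "trace (P ** Q) = z" for P Q :: "complex^2^2" and c
    using that unfolding C_def by (simp add: mat2_simps) algebra
  \<comment> \<open>As \<open>adj2 R\<close> is \<open>trace R\<close> minus \<open>R\<close>,
    inverse letters reuse the coordinates found for \<open>R\<close>.\<close>
  have adj: "adj2 R ** C P Q c = C P Q (\<lambda>i. trace R * c i - d i)"
    if "R ** C P Q c = C P Q d" for R P Q :: "complex^2^2" and c d
  proof -
    have "adj2 R ** C P Q c = (\<chi> i j. trace R * C P Q c $ i $ j) - R ** C P Q c"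
      by (simp add: adj2_def mat2_simps algebra_simps)
    then show ?thesis
      unfolding that by (simp add: C_def vec_eq_iff algebra_simps)
  qed
  have "\<exists>c. word_eval A B w = C A B c \<and> word_eval A' B' w = C A' B' c"
  proof (induction w)
    case Nil
    show ?case by (rule exI[of _ "\<lambda>i. if i = 0 then 1 else 0"]) (simp add: C_def vec_eq_iff)
  next
    case (Cons l w)
    then obtain c where "word_eval A B w = C A B c" "word_eval A' B' w = C A' B' c"
      by blast
    then show ?case
      using mulA[of A B c] mulA[of A' B' c] mulB[of A B c] mulB[of B A c] mulB[of A' B' c] assms
        adj[OF mulA[of A B c]] adj[OF mulA[of A' B' c]] adj[OF mulB[of A B c]] adj[OF mulB[of A' B' c]]
      by (cases "fst l"; cases "snd l") (auto simp: x_y_z_def)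
  qed
  then obtain c where "word_eval A B w = C A B c" "word_eval A' B' w = C A' B' c"
    by blast
  moreover have "trace (C P Q c) = 2 * c 0 + c 1 * trace P + c 2 * trace Q + c 3 * trace (P ** Q)" for P Q
    by (simp add: C_def trace_2 mat_def algebra_simps)
  ultimately show ?thesis
    using assms by simp
qed

lemma continuous_word_eval:
  fixes A B :: "real \<Rightarrow> complex^2^2"
  assumes "\<And>i j. continuous_on S (\<lambda>t. A t $ i $ j)" "\<And>i j. continuous_on S (\<lambda>t. B t $ i $ j)"
  shows "continuous_on S (\<lambda>t. word_eval (A t) (B t) w $ i $ j)"
proof (induction w arbitrary: i j)
  case (Cons l w)
  have "continuous_on S (\<lambda>t. adj2 (C t) $ i $ j)"
    if "\<And>i j. continuous_on S (\<lambda>t. C t $ i $ j)" for C i j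
    using that exhaust_2[of i] exhaust_2[of j]
    by (auto simp: adj2_entries continuous_on_minus)
  then have "continuous_on S (\<lambda>t. (if snd l then letter_eval (A t) (B t) (fst l)
      else adj2 (letter_eval (A t) (B t) (fst l))) $ i $ j)" for i j
    using assms by (cases "fst l"; cases "snd l") simp_all
  then show ?case
    using Cons by (simp add: matrix_matrix_mult_def del: if_split_asm)
      (rule continuous_on_sum continuous_on_mult | assumption | simp)+
qed simp

section \<open>Representations of the torus knot group as pairs\<close>

definition relator :: "nat \<Rightarrow> nat \<Rightarrow> (xy word \<times> xy word) set" where
  "relator m n = {(replicate m (gen_x, True), replicate n (gen_y, True))}"

lemma torus_knot_group_relator: "torus_knot_group m n = presented_group (relator m n)"
  by (simp add: torus_knot_group_def relator_def)

lemma carrier_torus_knot_group: "carrier (torus_knot_group m n) = range (word_class (relator m n))"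
  by (simp add: torus_knot_group_relator presented_group_def)

text \<open>The relation is stated on words rather than on matrix powers, so that it is literally
  the \<open>rel\<close> case of word equivalence.\<close>

definition rep_pair :: "nat \<Rightarrow> nat \<Rightarrow> complex^2^2 \<Rightarrow> complex^2^2 \<Rightarrow> bool" where
  "rep_pair m n A B \<longleftrightarrow> A \<in> carrier SU2 \<and> B \<in> carrier SU2 \<and>
     word_eval A B (replicate m (gen_x, True)) = word_eval A B (replicate n (gen_y, True))"

definition common_eigenvector :: "complex^2^2 \<Rightarrow> complex^2^2 \<Rightarrow> bool" where
  "common_eigenvector A B \<longleftrightarrow> (\<exists>v c d. v \<noteq> 0 \<and> A *v v = c *s v \<and> B *v v = d *s v)"

text \<open>The choice of a representative is harmless for a \<open>rep_pair\<close>, by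
  \<open>word_eval_word_eq\<close>.\<close>

definition rep_of_pair :: "complex^2^2 \<Rightarrow> complex^2^2 \<Rightarrow> xy word set \<Rightarrow> complex^2^2" where
  "rep_of_pair A B g = word_eval A B (SOME w. w \<in> g)"

lemma word_eval_word_eq:
  assumes "rep_pair m n A B" "word_eq (relator m n) u v"
  shows "word_eval A B u = word_eval A B v"
  using assms(2)
proof induction
  case (cancel a b)
  have "det A = 1" "det B = 1"
    using assms(1) by (simp_all add: rep_pair_def SU2_det)
  then show ?case
    by (cases a; cases b) (simp_all add: adj2_mult mult_adj2)
next
  case (rel u v)
  then show ?case
    using assms(1) by (simp add: relator_def rep_pair_def)
qed (simp_all add: word_eval_append)

lemma rep_of_pair_class:
  assumes "rep_pair m n A B"
  shows "rep_of_pair A B (word_class (relator m n) w) = word_eval A B w"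
proof -
  have "(SOME v. v \<in> word_class (relator m n) w) \<in> word_class (relator m n) w"
    by (rule someI[of _ w]) (simp add: word_class_def word_eq.refl)
  then show ?thesis
    unfolding rep_of_pair_def using word_eval_word_eq[OF assms] by (simp add: word_class_def)
qed

lemma rep_of_pair_hom:
  assumes "rep_pair m n A B"
  shows "rep_of_pair A B \<in> hom (torus_knot_group m n) SU2"
proof -
  have "rep_of_pair A B g \<in> carrier SU2" if "g \<in> carrier (torus_knot_group m n)" for g
    using that assms
    by (auto simp: carrier_torus_knot_group rep_of_pair_class rep_pair_def intro: word_eval_SU2)
  moreover have "rep_of_pair A B (g \<otimes>\<^bsub>torus_knot_group m n\<^esub> h) = rep_of_pair A B g ** rep_of_pair A B h"
    if "g \<in> carrier (torus_knot_group m n)" "h \<in> carrier (torus_knot_group m n)" for g h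
  proof -
    obtain u v where "g = word_class (relator m n) u" "h = word_class (relator m n) v"
      using \<open>g \<in> _\<close> \<open>h \<in> _\<close> by (auto simp: carrier_torus_knot_group)
    then show ?thesis
      using assms by (simp add: torus_knot_group_relator mult_word_class rep_of_pair_class word_eval_append)
  qed
  ultimately show ?thesis
    by (auto simp: hom_def SU2_def SL2_def)
qed

lemma hom_imp_rep_of_pair:
  assumes "\<rho> \<in> hom (torus_knot_group m n) SU2"
  obtains A B where "rep_pair m n A B"
    "\<And>g. g \<in> carrier (torus_knot_group m n) \<Longrightarrow> \<rho> g = rep_of_pair A B g"
proof -
  define cl where "cl = word_class (relator m n)"
  define A B where "A = \<rho> (cl [(gen_x, True)])" "B = \<rho> (cl [(gen_y, True)])"
  have cl: "cl w \<in> carrier (torus_knot_group m n)" for w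
    by (simp add: cl_def carrier_torus_knot_group)
  have S: "\<rho> (cl w) \<in> carrier SU2" for w
    using assms cl by (auto simp: hom_def)
  have mult: "\<rho> (cl (u @ v)) = \<rho> (cl u) ** \<rho> (cl v)" for u v
  proof -
    have "\<rho> (cl u \<otimes>\<^bsub>torus_knot_group m n\<^esub> cl v) = \<rho> (cl u) ** \<rho> (cl v)"
      using assms cl by (auto simp: hom_def SU2_def SL2_def)
    then show ?thesis
      by (simp add: cl_def torus_knot_group_relator mult_word_class)
  qed
  \<comment> \<open>Membership in \<open>hom\<close> gives multiplicativity only; an invertible
    idempotent is the identity.\<close>
  have one: "\<rho> (cl []) = mat 1"
  proof -
    have "\<rho> (cl []) = adj2 (\<rho> (cl [])) ** (\<rho> (cl []) ** \<rho> (cl []))"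
      by (simp add: matrix_mul_assoc adj2_mult S SU2_det)
    also have "\<dots> = mat 1"
      using mult[of "[]" "[]"] by (simp add: adj2_mult S SU2_det)
    finally show ?thesis .
  qed
  have inv: "\<rho> (cl [(a, False)]) = adj2 (\<rho> (cl [(a, True)]))" for a
  proof -
    have "cl [(a, True), (a, False)] = cl []"
      using word_eq.cancel[of _ a True] by (simp add: cl_def word_class_eq_iff)
    then have "\<rho> (cl [(a, True)]) ** \<rho> (cl [(a, False)]) = mat 1"
      using mult[of "[(a, True)]" "[(a, False)]"] one by simp
    then have "adj2 (\<rho> (cl [(a, True)])) ** (\<rho> (cl [(a, True)]) ** \<rho> (cl [(a, False)]))
        = adj2 (\<rho> (cl [(a, True)]))"
      by simp
    then show ?thesis
      by (simp add: matrix_mul_assoc adj2_mult S SU2_det)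
  qed
  have eval: "\<rho> (cl w) = word_eval A B w" for w
  proof (induction w)
    case (Cons l w)
    obtain a b where "l = (a, b)" by (cases l)
    then show ?case
      using mult[of "[l]" w] Cons inv by (cases a; cases b) (simp_all add: A_B_def)
  qed (simp add: one)
  have "cl (replicate m (gen_x, True)) = cl (replicate n (gen_y, True))"
    by (simp add: cl_def word_class_eq_iff relator_def word_eq.rel)
  then have P: "rep_pair m n A B"
    unfolding rep_pair_def using S by (metis A_B_def eval)
  moreover have "\<rho> g = rep_of_pair A B g" if "g \<in> carrier (torus_knot_group m n)" for g
    using that eval rep_of_pair_class[OF P] by (auto simp: carrier_torus_knot_group cl_def)
  ultimately show ?thesis
    using that by blast
qed

lemma reducible_rep_of_pair_iff:
  assumes "rep_pair m n A B"
  shows "reducible (torus_knot_group m n) (rep_of_pair A B) \<longleftrightarrow> common_eigenvector A B"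
proof
  assume "reducible (torus_knot_group m n) (rep_of_pair A B)"
  then obtain v where v: "v \<noteq> 0" "\<And>w. \<exists>c. word_eval A B w *v v = c *s v"
    by (auto simp: reducible_def carrier_torus_knot_group rep_of_pair_class[OF assms])
  then show "common_eigenvector A B"
    using v(2)[of "[(gen_x, True)]"] v(2)[of "[(gen_y, True)]"]
    by (auto simp: common_eigenvector_def)
next
  assume "common_eigenvector A B"
  then obtain v where v: "v \<noteq> 0" and AB: "\<exists>c. A *v v = c *s v" "\<exists>c. B *v v = c *s v"
    by (auto simp: common_eigenvector_def)
  have adj: "\<exists>c. adj2 C *v v = c *s v" if "\<exists>c. C *v v = c *s v" for C
  proof -
    from that obtain c where "C *v v = c *s v" by blast
    then have "adj2 C *v v = (trace C - c) *s v"
      by (simp add: adj2_def matrix_vector_mult_diff_rdistrib vector_sub_rdistrib)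
        (simp add: mat2_simps algebra_simps)
    then show ?thesis ..
  qed
  have "\<exists>c. word_eval A B w *v v = c *s v" for w
  proof (induction w)
    case Nil
    have "word_eval A B [] *v v = 1 *s v" by simp
    then show ?case ..
  next
    case (Cons l w)
    have "\<exists>c. (if snd l then letter_eval A B (fst l) else adj2 (letter_eval A B (fst l))) *v v = c *s v"
      using AB adj by (cases "fst l") auto
    then show ?case
      using Cons by (auto simp: matrix_vector_mul_assoc[symmetric] vector_scalar_commute simp del: if_split)
  qed
  then show "reducible (torus_knot_group m n) (rep_of_pair A B)"
    unfolding reducible_def using v by (auto simp: carrier_torus_knot_group rep_of_pair_class[OF assms])
qed

definition pair_character :: "nat \<Rightarrow> nat \<Rightarrow> complex^2^2 \<Rightarrow> complex^2^2 \<Rightarrow> xy word set \<Rightarrow> complex" where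
  "pair_character m n A B = rep_character (torus_knot_group m n) (rep_of_pair A B)"

lemma pair_character_class:
  assumes "rep_pair m n A B"
  shows "pair_character m n A B (word_class (relator m n) w) = trace (word_eval A B w)"
  using assms by (simp add: pair_character_def rep_character_def carrier_torus_knot_group rep_of_pair_class)

text \<open>The predicate \<open>Q\<close> on truth values lets one proof serve all characters, the
  reducible ones and the irreducible ones.\<close>

lemma SU2_hom_character_iff:
  "(\<exists>\<rho>\<in>hom (torus_knot_group m n) SU2. Q (reducible (torus_knot_group m n) \<rho>)
      \<and> f = rep_character (torus_knot_group m n) \<rho>)
   \<longleftrightarrow> (\<exists>A B. rep_pair m n A B \<and> Q (common_eigenvector A B) \<and> f = pair_character m n A B)"
proof
  assume "\<exists>\<rho>\<in>hom (torus_knot_group m n) SU2. Q (reducible (torus_knot_group m n) \<rho>)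
      \<and> f = rep_character (torus_knot_group m n) \<rho>"
  then obtain \<rho> where r: "\<rho> \<in> hom (torus_knot_group m n) SU2"
    "Q (reducible (torus_knot_group m n) \<rho>)" "f = rep_character (torus_knot_group m n) \<rho>"
    by blast
  from hom_imp_rep_of_pair[OF r(1)] obtain A B where P: "rep_pair m n A B"
    and e: "\<And>g. g \<in> carrier (torus_knot_group m n) \<Longrightarrow> \<rho> g = rep_of_pair A B g"
    by metis
  have "reducible (torus_knot_group m n) \<rho> \<longleftrightarrow> reducible (torus_knot_group m n) (rep_of_pair A B)"
    by (simp add: reducible_def e)
  moreover have "f = pair_character m n A B"
    by (auto simp: r(3) pair_character_def rep_character_def e intro!: restrict_ext)
  ultimately show "\<exists>A B. rep_pair m n A B \<and> Q (common_eigenvector A B) \<and> f = pair_character m n A B"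
    using P r(2) by (auto simp: reducible_rep_of_pair_iff)
next
  assume "\<exists>A B. rep_pair m n A B \<and> Q (common_eigenvector A B) \<and> f = pair_character m n A B"
  then show "\<exists>\<rho>\<in>hom (torus_knot_group m n) SU2. Q (reducible (torus_knot_group m n) \<rho>)
      \<and> f = rep_character (torus_knot_group m n) \<rho>"
    unfolding pair_character_def Bex_def using rep_of_pair_hom reducible_rep_of_pair_iff
    by (elim exE conjE, intro exI conjI) auto
qed

lemma SU2_characters_pairs:
  "SU2_characters (torus_knot_group m n) = {f. \<exists>A B. rep_pair m n A B \<and> f = pair_character m n A B}"
  "SU2_characters_red (torus_knot_group m n) =
     {f. \<exists>A B. rep_pair m n A B \<and> common_eigenvector A B \<and> f = pair_character m n A B}"
  "SU2_characters_irr (torus_knot_group m n) =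
     {f. \<exists>A B. rep_pair m n A B \<and> \<not> common_eigenvector A B \<and> f = pair_character m n A B}"
  using SU2_hom_character_iff[of m n "\<lambda>_. True"] SU2_hom_character_iff[of m n "\<lambda>b. b"]
    SU2_hom_character_iff[of m n Not]
  by (simp_all add: set_eq_iff SU2_characters_def SU2_characters_red_def SU2_characters_irr_def image_iff Bex_def conj_assoc)

lemma pair_character_cong:
  assumes "rep_pair m n A B" "rep_pair m n A' B'"
    and "trace A' = trace A" "trace B' = trace B" "trace (A' ** B') = trace (A ** B)"
  shows "pair_character m n A' B' = pair_character m n A B"
proof -
  have "trace (rep_of_pair A' B' g) = trace (rep_of_pair A B g)" for g
    unfolding rep_of_pair_def using assms
    by (intro word_eval_cong_traces) (simp_all add: rep_pair_def SU2_det)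
  then show ?thesis
    by (simp add: pair_character_def rep_character_def)
qed

text \<open>The traces are the values of the character at the classes of x, y and x y.\<close>

lemma pair_character_traces:
  assumes "rep_pair m n A B" "rep_pair m n A' B'" "pair_character m n A' B' = pair_character m n A B"
  shows "trace A' = trace A" "trace B' = trace B" "trace (A' ** B') = trace (A ** B)"
proof -
  have "trace (word_eval A' B' w) = trace (word_eval A B w)" for w
    using assms pair_character_class by metis
  from this[of "[(gen_x, True)]"] this[of "[(gen_y, True)]"] this[of "[(gen_x, True), (gen_y, True)]"]
  show "trace A' = trace A" "trace B' = trace B" "trace (A' ** B') = trace (A ** B)"
    by simp_all
qed

section \<open>Common eigenvectors\<close>

lemma ex_eigenvector_2:
  fixes A :: "complex^2^2"
  shows "\<exists>v c. v \<noteq> 0 \<and> A *v v = c *s v"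
proof (cases "A$1$2 = 0")
  case True
  then have "A *v vector [0, 1] = A$2$2 *s vector [0, 1]" "(vector [0, 1] :: complex^2) \<noteq> 0"
    by (simp_all add: mat2_simps)
  then show ?thesis by blast
next
  case False
  define t d where "t = A$1$1 + A$2$2" "d = A$1$1 * A$2$2 - A$1$2 * A$2$1"
  define c where "c = (t + csqrt (t\<^sup>2 - 4 * d)) / 2"
  have "2 * c - t = csqrt (t\<^sup>2 - 4 * d)"
    by (simp add: c_def diff_divide_distrib add_divide_distrib)
  then have "(2 * c - t)\<^sup>2 = t\<^sup>2 - 4 * d"
    by simp
  then have c: "c * c = t * c - d"
    by algebra
  \<comment> \<open>The first row of this equation is an identity in \<open>c\<close>; the second is
    the characteristic equation.\<close>
  then have "A *v vector [A$1$2, c - A$1$1] = c *s vector [A$1$2, c - A$1$1]"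
    by (simp add: mat2_simps t_d_def algebra_simps)
  moreover have "vector [A$1$2, c - A$1$1] \<noteq> (0 :: complex^2)"
    using False by (simp add: mat2_simps)
  ultimately show ?thesis by blast
qed

text \<open>A matrix commuting with a non-scalar 2 by 2 matrix \<open>A\<close> has the form q A +
  p, so an eigenvector of \<open>A\<close> serves both. The ratio q is read off at a nonzero
  off-diagonal entry or at the difference of the diagonal entries. For scalar \<open>A\<close> any
  eigenvector of \<open>B\<close> will do.\<close>

lemma common_eigenvector_if_commute:
  assumes "A ** B = B ** A"
  shows "common_eigenvector A B"
proof -
  have e: "A$1$2 * B$2$1 = B$1$2 * A$2$1"
    "A$1$1 * B$1$2 + A$1$2 * B$2$2 = B$1$1 * A$1$2 + B$1$2 * A$2$2"
    "A$2$1 * B$1$1 + A$2$2 * B$2$1 = B$2$1 * A$1$1 + B$2$2 * A$2$1"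
    using arg_cong[OF assms, of "\<lambda>M. M$1$1"] arg_cong[OF assms, of "\<lambda>M. M$1$2"]
      arg_cong[OF assms, of "\<lambda>M. M$2$1"]
    by (simp_all add: matrix_matrix_mult_def sum_2 mult.commute[of "A$1$1" "B$1$1"])
  have lin: "common_eigenvector A B" if "\<And>i j. B$i$j = q * A$i$j + p * mat 1 $i$j" for p q
  proof -
    obtain v c where v: "v \<noteq> 0" "A *v v = c *s v"
      using ex_eigenvector_2 by blast
    have "B *v v = q *s (A *v v) + p *s v"
      by (simp add: mat2_simps that algebra_simps)
    then have "B *v v = (q * c + p) *s v"
      by (simp add: v vec_eq_iff algebra_simps)
    then show ?thesis
      using v unfolding common_eigenvector_def by blast
  qed
  have B: "common_eigenvector A B" if "B$1$2 = q * A$1$2" "B$2$1 = q * A$2$1"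
    "B$2$2 = B$1$1 + q * (A$2$2 - A$1$1)" for q
  proof (rule lin[of q "B$1$1 - q * A$1$1"])
    show "B$i$j = q * A$i$j + (B$1$1 - q * A$1$1) * mat 1 $i$j" for i j
      using that exhaust_2[of i] exhaust_2[of j] by (auto simp: mat_def algebra_simps)
  qed
  consider "A$1$2 \<noteq> 0" | "A$1$2 = 0" "A$2$1 \<noteq> 0" | "A$1$2 = 0" "A$2$1 = 0" "A$1$1 \<noteq> A$2$2"
    | "A$1$2 = 0" "A$2$1 = 0" "A$1$1 = A$2$2" by blast
  then show ?thesis
  proof cases
    case 1
    define q where "q = B$1$2 / A$1$2"
    have q: "B$1$2 = q * A$1$2" using 1 by (simp add: q_def)
    have "A$1$2 * (B$2$1 - q * A$2$1) = 0" "A$1$2 * (B$2$2 - (B$1$1 + q * (A$2$2 - A$1$1))) = 0"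
      using e(1,2) unfolding q by (simp_all add: algebra_simps)
    then have "B$2$1 = q * A$2$1" "B$2$2 = B$1$1 + q * (A$2$2 - A$1$1)"
      using 1 by simp_all
    with q show ?thesis by (intro B)
  next
    case 2
    define q where "q = B$2$1 / A$2$1"
    have q: "B$2$1 = q * A$2$1" using 2 by (simp add: q_def)
    have "A$2$1 * B$1$2 = 0" "A$2$1 * (B$2$2 - (B$1$1 + q * (A$2$2 - A$1$1))) = 0"
      using e(1,3) 2 unfolding q by (simp_all add: algebra_simps)
    then have "B$1$2 = q * A$1$2" "B$2$2 = B$1$1 + q * (A$2$2 - A$1$1)"
      using 2 by simp_all
    with q show ?thesis by (intro B)
  next
    case 3
    define q where "q = (B$2$2 - B$1$1) / (A$2$2 - A$1$1)"
    have q: "B$2$2 = B$1$1 + q * (A$2$2 - A$1$1)" using 3 by (simp add: q_def)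
    have "B$1$2 = 0" "B$2$1 = 0"
      using e(2,3) 3 by auto
    with q 3 show ?thesis by (intro B[of q]) simp_all
  next
    case 4
    obtain v c where v: "v \<noteq> 0" "B *v v = c *s v"
      using ex_eigenvector_2 by blast
    moreover have "A *v v = A$1$1 *s v"
      using 4 by (simp add: mat2_simps)
    ultimately show ?thesis
      unfolding common_eigenvector_def by blast
  qed
qed

text \<open>Cayley--Hamilton applied to \<open>v\<close>, compared in a nonzero coordinate.\<close>

lemma eigenvalue_eq:
  fixes A :: "complex^2^2"
  assumes "det A = 1" "v \<noteq> 0" "A *v v = c *s v"
  shows "c * c = trace A * c - 1"
proof -
  have "A *v (A *v v) = trace A *s (A *v v) - v"
    using assms(1) by (simp add: mat2_simps) algebra
  then have e: "(c * c - (trace A * c - 1)) * v $ i = 0" for i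
    by (simp add: assms(3) vector_scalar_commute vec_eq_iff algebra_simps)
  obtain i where "v $ i \<noteq> 0"
    using assms(2) by (auto simp: vec_eq_iff)
  with e[of i] show ?thesis
    by simp
qed

text \<open>By Fricke's formula the left side minus 2 is the trace of the commutator, which has
  eigenvalue 1 on a common eigenvector and hence trace 2. The proof substitutes the eigenvalues
  directly.\<close>

lemma common_eigenvector_trace_identity:
  assumes "det A = 1" "det B = 1" "common_eigenvector A B"
  shows "(trace A)\<^sup>2 + (trace B)\<^sup>2 + (trace (A ** B))\<^sup>2 - trace A * trace B * trace (A ** B) = 4"
proof -
  obtain v c d where v: "v \<noteq> 0" "A *v v = c *s v" "B *v v = d *s v"
    using assms(3) by (auto simp: common_eigenvector_def)
  then have "(A ** B) *v v = (c * d) *s v"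
    by (simp add: matrix_vector_mul_assoc[symmetric] vector_scalar_commute mult.commute)
  with v have e: "c * c = trace A * c - 1" "d * d = trace B * d - 1"
      "(c * d) * (c * d) = trace (A ** B) * (c * d) - 1"
    using assms by (auto intro!: eigenvalue_eq simp: det_mul)
  have "c \<noteq> 0" "d \<noteq> 0"
    using e by auto
  then have tr: "trace A = c + 1 / c" "trace B = d + 1 / d" "trace (A ** B) = c * d + 1 / (c * d)"
    using e by (simp_all add: field_simps)
  show ?thesis
    unfolding tr using \<open>c \<noteq> 0\<close> \<open>d \<noteq> 0\<close> by (simp add: field_simps power2_eq_square)
qed

text \<open>For these matrices the left side of the assumption equals 4 - 4 (sin a sin b sin
  \<phi>)^2.\<close>

lemma trace_identity_rot:
  fixes a b \<phi> :: real
  defines "x \<equiv> trace (rot 0 a)" and "y \<equiv> trace (rot \<phi> b)" and "z \<equiv> trace (rot 0 a ** rot \<phi> b)"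
  assumes "x\<^sup>2 + y\<^sup>2 + z\<^sup>2 - x * y * z = 4"
  shows "sin a * sin b * sin \<phi> = 0"
proof -
  have "(complex_of_real (2 * cos a))\<^sup>2 + (of_real (2 * cos b))\<^sup>2 + (of_real (2 * (cos a * cos b - sin a * sin b * cos \<phi>)))\<^sup>2
     - of_real (2 * cos a) * of_real (2 * cos b) * of_real (2 * (cos a * cos b - sin a * sin b * cos \<phi>)) = 4"
    using assms(4) unfolding x_def y_def z_def trace_rot trace_rot_mult .
  then have "complex_of_real ((2 * cos a)\<^sup>2 + (2 * cos b)\<^sup>2 + (2 * (cos a * cos b - sin a * sin b * cos \<phi>))\<^sup>2
     - (2 * cos a) * (2 * cos b) * (2 * (cos a * cos b - sin a * sin b * cos \<phi>))) = of_real 4"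
    by (simp only: of_real_diff of_real_add of_real_power of_real_mult of_real_numeral)
  then have "(2 * cos a)\<^sup>2 + (2 * cos b)\<^sup>2 + (2 * (cos a * cos b - sin a * sin b * cos \<phi>))\<^sup>2
     - (2 * cos a) * (2 * cos b) * (2 * (cos a * cos b - sin a * sin b * cos \<phi>)) = 4"
    by (simp only: of_real_eq_iff)
  then have "(1 - (cos a)\<^sup>2) * (1 - (cos b)\<^sup>2) = (sin a * sin b * cos \<phi>)\<^sup>2"
    by (simp add: power2_eq_square algebra_simps)
  then have "(sin a)\<^sup>2 * (sin b)\<^sup>2 * (1 - (cos \<phi>)\<^sup>2) = 0"
    by (simp add: sin_squared_eq[of a] sin_squared_eq[of b] power_mult_distrib algebra_simps)
  then have "(sin a * sin b * sin \<phi>)\<^sup>2 = 0"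
    by (simp add: sin_squared_eq[of \<phi>] power_mult_distrib)
  then show ?thesis
    by simp
qed

section \<open>Traces of pairs in SU(2) and powers of a matrix\<close>

lemma SU2_angle:
  assumes "A \<in> carrier SU2"
  obtains \<alpha> where "0 \<le> \<alpha>" "\<alpha> \<le> pi" "trace A = of_real (2 * cos \<alpha>)"
proof
  have "Re (A$1$1 * cnj (A$1$1) + A$1$2 * cnj (A$1$2)) = 1"
    using assms by (simp add: SU2_iff)
  then have "(Re (A$1$1))\<^sup>2 + ((Im (A$1$1))\<^sup>2 + ((Re (A$1$2))\<^sup>2 + (Im (A$1$2))\<^sup>2)) = 1"
    by (simp add: power2_eq_square)
  then have "(Re (A$1$1))\<^sup>2 \<le> 1"
    by (smt (verit) zero_le_power2)
  then have "\<bar>Re (A$1$1)\<bar> \<le> 1"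
    by (simp add: abs_square_le_1)
  then show "0 \<le> arccos (Re (A$1$1))" "arccos (Re (A$1$1)) \<le> pi"
    "trace A = of_real (2 * cos (arccos (Re (A$1$1))))"
    using assms by (auto simp: arccos_lbound arccos_ubound trace_2 SU2_iff complex_eq_iff)
qed

text \<open>In real coordinates \<open>D\<close> is the inner product of the imaginary parts of two
  unit quaternions, and \<open>c1\<close>, \<open>c2\<close>, \<open>c3\<close> are up to sign the
  entries of their cross product. It vanishes only if the quaternions commute, so Lagrange's
  identity makes Cauchy--Schwarz strict; up to sign \<open>c\<close> is the cosine of the angle
  between the axes.\<close>

lemma SU2_pair_irreducible:
  assumes "A \<in> carrier SU2" "B \<in> carrier SU2" "\<not> common_eigenvector A B"
    and "trace A = of_real (2 * cos \<alpha>)" "trace B = of_real (2 * cos \<beta>)"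
  obtains c where "-1 < c" "c < 1" "sin \<alpha> \<noteq> 0" "sin \<beta> \<noteq> 0"
    "trace (A ** B) = of_real (2 * (cos \<alpha> * cos \<beta> - sin \<alpha> * sin \<beta> * c))"
proof -
  obtain a0 a1 where a: "A$1$1 = Complex a0 a1" by (cases "A$1$1")
  obtain a2 a3 where a': "A$1$2 = Complex a2 a3" by (cases "A$1$2")
  obtain b0 b1 where b: "B$1$1 = Complex b0 b1" by (cases "B$1$1")
  obtain b2 b3 where b': "B$1$2 = Complex b2 b3" by (cases "B$1$2")
  have A: "A$2$1 = Complex (- a2) a3" "A$2$2 = Complex a0 (- a1)" "a0\<^sup>2 + a1\<^sup>2 + a2\<^sup>2 + a3\<^sup>2 = 1"
    using assms(1) by (auto simp: SU2_iff a a' complex_eq_iff power2_eq_square)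
  have B: "B$2$1 = Complex (- b2) b3" "B$2$2 = Complex b0 (- b1)" "b0\<^sup>2 + b1\<^sup>2 + b2\<^sup>2 + b3\<^sup>2 = 1"
    using assms(2) by (auto simp: SU2_iff b b' complex_eq_iff power2_eq_square)
  have cos: "a0 = cos \<alpha>" "b0 = cos \<beta>"
    using assms(4,5) by (auto simp: trace_2 a b A B complex_eq_iff)
  define D where "D = a1 * b1 + a2 * b2 + a3 * b3"
  have z: "trace (A ** B) = of_real (2 * (a0 * b0 - D))"
    by (simp add: mat2_simps a a' b b' A B complex_eq_iff D_def algebra_simps)
  have sin: "(sin \<alpha>)\<^sup>2 = a1\<^sup>2 + a2\<^sup>2 + a3\<^sup>2" "(sin \<beta>)\<^sup>2 = b1\<^sup>2 + b2\<^sup>2 + b3\<^sup>2"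
    using A(3) B(3) sin_squared_eq[of \<alpha>] sin_squared_eq[of \<beta>] by (auto simp: cos)
  define c1 c2 c3 where "c1 = a1 * b2 - a2 * b1" "c2 = a1 * b3 - a3 * b1" "c3 = a2 * b3 - a3 * b2"
  have "c1 \<noteq> 0 \<or> c2 \<noteq> 0 \<or> c3 \<noteq> 0"
  proof (rule ccontr)
    assume "\<not> ?thesis"
    then have "A ** B = B ** A"
      by (simp add: mat2_simps a a' b b' A B complex_eq_iff c1_c2_c3_def algebra_simps)
    then show False
      using assms(3) common_eigenvector_if_commute by blast
  qed
  then have "c1\<^sup>2 + c2\<^sup>2 + c3\<^sup>2 > 0"
    by (smt (verit) zero_less_power2 zero_le_power2)
  moreover have "(sin \<alpha>)\<^sup>2 * (sin \<beta>)\<^sup>2 = D\<^sup>2 + (c1\<^sup>2 + c2\<^sup>2 + c3\<^sup>2)"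
    unfolding sin D_def c1_c2_c3_def by algebra
  ultimately have less: "D\<^sup>2 < (sin \<alpha> * sin \<beta>)\<^sup>2"
    by (simp add: power_mult_distrib)
  then have nz: "sin \<alpha> \<noteq> 0" "sin \<beta> \<noteq> 0"
    by (auto simp: not_less)
  define c where "c = D / (sin \<alpha> * sin \<beta>)"
  have "c\<^sup>2 < 1"
    using less nz by (simp add: c_def power_divide divide_simps)
  then have "-1 < c" "c < 1"
    by (auto simp: abs_square_less_1 abs_less_iff)
  moreover have "D = sin \<alpha> * sin \<beta> * c"
    using nz by (simp add: c_def)
  ultimately show ?thesis
    using that nz z by (simp add: cos)
qed

text \<open>Cayley--Hamilton: \<open>A\<^sup>k = U\<^sub>k\<^sub>-\<^sub>1 A - U\<^sub>k\<^sub>-\<^sub>2\<close> with Chebyshev polynomials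
  \<open>U\<^sub>k (cos \<alpha>) = sin ((k + 1) \<alpha>) / sin \<alpha>\<close>; the factor \<open>sin \<alpha>\<close> is kept to allow \<open>sin \<alpha> = 0\<close>.\<close>

lemma word_eval_replicate_sin:
  assumes "det A = 1" "trace A = of_real (2 * cos \<alpha>)"
  shows "of_real (sin \<alpha>) * word_eval A B (replicate k (gen_x, True)) $ i $ j
     = of_real (sin (k * \<alpha>)) * A $ i $ j - of_real (sin ((real k - 1) * \<alpha>)) * mat 1 $ i $ j"
    "of_real (sin \<alpha>) * word_eval B A (replicate k (gen_y, True)) $ i $ j
     = of_real (sin (k * \<alpha>)) * A $ i $ j - of_real (sin ((real k - 1) * \<alpha>)) * mat 1 $ i $ j"
proof -
  have step: "of_real (sin \<alpha>) * (A ** M) $ i $ j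
      = of_real (sin (Suc k * \<alpha>)) * A $ i $ j - of_real (sin ((real (Suc k) - 1) * \<alpha>)) * mat 1 $ i $ j"
    if M: "\<And>i j. of_real (sin \<alpha>) * M $ i $ j
      = of_real (sin (k * \<alpha>)) * A $ i $ j - of_real (sin ((real k - 1) * \<alpha>)) * mat 1 $ i $ j" for M k i j
  proof -
    have ch: "(A ** A) $ i $ j = of_real (2 * cos \<alpha>) * A $ i $ j - mat 1 $ i $ j" for i j
    proof -
      have "A ** A = (\<chi> i j. trace A * A $ i $ j - mat 1 $ i $ j)"
        using assms(1) by (simp add: mat2_simps) algebra
      then show ?thesis by (simp add: assms(2))
    qed
    have "of_real (sin \<alpha>) * (A ** M) $ i $ j = (\<Sum>l\<in>UNIV. A $ i $ l * (of_real (sin \<alpha>) * M $ l $ j))"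
      by (simp add: matrix_matrix_mult_def sum_2 distrib_left mult.left_commute)
    also have "\<dots> = of_real (sin (k * \<alpha>)) * (A ** A) $ i $ j - of_real (sin ((real k - 1) * \<alpha>)) * (A ** mat 1) $ i $ j"
      unfolding M by (simp add: matrix_matrix_mult_def sum_2) algebra
    also have "\<dots> = of_real (2 * cos \<alpha> * sin (k * \<alpha>) - sin ((real k - 1) * \<alpha>)) * A $ i $ j - of_real (sin (k * \<alpha>)) * mat 1 $ i $ j"
      unfolding ch by simp algebra
    also have "2 * cos \<alpha> * sin (k * \<alpha>) - sin ((real k - 1) * \<alpha>) = sin (Suc k * \<alpha>)"
      using sin_add[of "k * \<alpha>" \<alpha>] sin_diff[of "k * \<alpha>" \<alpha>] by (simp add: algebra_simps)
    finally show ?thesis by simp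
  qed
  show "of_real (sin \<alpha>) * word_eval A B (replicate k (gen_x, True)) $ i $ j
     = of_real (sin (k * \<alpha>)) * A $ i $ j - of_real (sin ((real k - 1) * \<alpha>)) * mat 1 $ i $ j"
  \<comment> \<open>The subtraction is real: at \<open>k = 0\<close> the second coefficient is
    \<open>sin (- \<alpha>)\<close>, which produces the identity matrix.\<close>
  proof (induction k arbitrary: i j)
    case (Suc k)
    then show ?case using step[of "word_eval A B (replicate k (gen_x, True))" k i j] by simp
  qed simp
  show "of_real (sin \<alpha>) * word_eval B A (replicate k (gen_y, True)) $ i $ j
     = of_real (sin (k * \<alpha>)) * A $ i $ j - of_real (sin ((real k - 1) * \<alpha>)) * mat 1 $ i $ j"
  proof (induction k arbitrary: i j)
    case (Suc k)
    then show ?case using step[of "word_eval B A (replicate k (gen_y, True))" k i j] by simp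
  qed simp
qed

section \<open>Classification of characters\<close>

lemma rot_nat_pi: "rot \<phi> (real k * pi) = mat ((-1) ^ k)"
  by (simp add: mat2_simps rot_entries complex_eq_iff)

lemma commute_if_linear:
  fixes A B :: "complex^2^2"
  assumes "p \<noteq> 0" "\<And>i j. p * A$i$j = q * B$i$j + r * mat 1$i$j"
  shows "A ** B = B ** A"
proof -
  have e: "p * A$1$1 = q * B$1$1 + r" "p * A$1$2 = q * B$1$2" "p * A$2$1 = q * B$2$1"
    "p * A$2$2 = q * B$2$2 + r"
    using assms(2)[of 1 1] assms(2)[of 1 2] assms(2)[of 2 1] assms(2)[of 2 2]
    by (simp_all add: mat_def)
  have "p * (A ** B)$i$j = p * (B ** A)$i$j" for i j
  proof -
    have "p * (A ** B)$i$j = p * A$i$1 * B$1$j + p * A$i$2 * B$2$j"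
      "p * (B ** A)$i$j = B$i$1 * (p * A$1$j) + B$i$2 * (p * A$2$j)"
      by (simp_all add: matrix_matrix_mult_def sum_2 algebra_simps)
    then show ?thesis
      unfolding assms(2) using exhaust_2[of i] exhaust_2[of j]
      by (auto simp: mat_def algebra_simps)
  qed
  then show ?thesis
    using assms(1) by (simp add: vec_eq_iff)
qed

text \<open>Equal cosines mean that the angles agree up to sign modulo 2 pi, and both options
  survive multiplication by an integer.\<close>

lemma cos_multiple_cong:
  fixes x y :: real
  assumes "cos x = cos y"
  shows "cos (real k * x) = cos (real k * y)"
proof -
  have "(sin x)\<^sup>2 = (sin y)\<^sup>2"
    by (simp add: sin_squared_eq assms)
  then have "sin x = sin y \<or> sin x = sin (- y)"
    by (simp add: power2_eq_iff)
  then have "cis x = cis y \<or> cis x = cis (- y)"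
    using assms by (simp add: complex_eq_iff)
  then have "cis (real k * x) = cis (real k * y) \<or> cis (real k * x) = cis (real k * - y)"
    by (metis Complex.DeMoivre)
  then show ?thesis
    by (auto simp: complex_eq_iff)
qed

lemma quadratic_root_cis:
  assumes "c * c = of_real (2 * cos \<alpha>) * c - 1"
  obtains \<alpha>' where "c = cis \<alpha>'"
proof -
  have "(c - cis \<alpha>) * (c - cis (- \<alpha>)) = c * c - (cis \<alpha> + cis (- \<alpha>)) * c + cis \<alpha> * cis (- \<alpha>)"
    by (simp add: algebra_simps)
  also have "cis \<alpha> * cis (- \<alpha>) = 1"
    by (simp add: cis_mult)
  also have "cis \<alpha> + cis (- \<alpha>) = of_real (2 * cos \<alpha>)"
    by (simp add: complex_eq_iff)
  finally have "(c - cis \<alpha>) * (c - cis (- \<alpha>)) = 0"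
    using assms by simp
  then show ?thesis
    using that by auto
qed

text \<open>For coprime m and n the pairs (s, t) on the unit circle with s^m = t^n form a single
  circle, parametrised by (w^n, w^m). Bezout coefficients with u m + v n = 1 give the inverse w =
  s^v t^u.\<close>

lemma cis_common_root:
  assumes "coprime m n" "cis (real m * a) = cis (real n * b)"
  obtains \<theta> where "cis a = cis (real n * \<theta>)" "cis b = cis (real m * \<theta>)"
proof -
  have "sin (real m * a) = sin (real n * b) \<and> cos (real m * a) = cos (real n * b)"
    using assms(2) by (simp add: complex_eq_iff)
  then obtain j :: int where j: "real m * a = real n * b + 2 * pi * j"
    unfolding sin_cos_eq_iff by blast
  have "gcd (int m) (int n) = 1"
    using assms(1) by (simp add: coprime_iff_gcd_eq_1[symmetric])
  then obtain u v :: int where "u * int m + v * int n = 1"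
    by (metis bezout_int)
  then have uv: "of_int u * real m + of_int v * real n = 1"
    by (metis of_int_1 of_int_add of_int_mult of_int_of_nat_eq)
  define \<theta> where "\<theta> = of_int v * a + of_int u * b"
  have per: "cis x = cis y" if "x = y + 2 * pi * of_int i" for x y i
    using that sin_cos_eq_iff[of x y] by (auto simp: complex_eq_iff)
  have "a = (of_int u * real m + of_int v * real n) * a"
    by (simp add: uv)
  also have "\<dots> = of_int u * (real m * a) + of_int v * real n * a"
    by (simp add: algebra_simps)
  also have "\<dots> = real n * \<theta> + 2 * pi * of_int (u * j)"
    unfolding j by (simp add: \<theta>_def algebra_simps)
  finally have 1: "cis a = cis (real n * \<theta>)"
    by (rule per)
  have "b = (of_int u * real m + of_int v * real n) * b"
    by (simp add: uv)
  also have "\<dots> = of_int u * real m * b + of_int v * (real m * a - 2 * pi * j)"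
    unfolding j by (simp add: algebra_simps)
  also have "\<dots> = real m * \<theta> + 2 * pi * of_int (- v * j)"
    by (simp add: \<theta>_def algebra_simps)
  finally have 2: "cis b = cis (real m * \<theta>)"
    by (rule per)
  from 1 2 show ?thesis by (rule that)
qed

lemma common_eigenvector_rot_diag:
  assumes "sin \<phi> = 0"
  shows "common_eigenvector (rot 0 a) (rot \<phi> b)"
proof -
  let ?v = "vector [1, 0] :: complex^2"
  have "?v \<noteq> 0" "rot 0 a *v ?v = rot 0 a $1$1 *s ?v" "rot \<phi> b *v ?v = rot \<phi> b $1$1 *s ?v"
    using assms by (simp_all add: mat2_simps rot_entries)
  then show ?thesis
    unfolding common_eigenvector_def by blast
qed

definition red_character :: "nat \<Rightarrow> nat \<Rightarrow> real \<Rightarrow> xy word set \<Rightarrow> complex" where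
  "red_character m n \<theta> = pair_character m n (rot 0 (real n * \<theta>)) (rot 0 (real m * \<theta>))"

text \<open>The matrices rotate by \<open>2 k \<pi> / m\<close> and \<open>2 l \<pi> / n\<close> about axes at angle \<open>\<phi>\<close>. The parity condition
  on the indices says that the \<open>m\<close>-th and \<open>n\<close>-th powers are the same sign \<open>(-1)\<^sup>k = (-1)\<^sup>l\<close>.\<close>

definition arc_character :: "nat \<Rightarrow> nat \<Rightarrow> nat \<Rightarrow> nat \<Rightarrow> real \<Rightarrow> xy word set \<Rightarrow> complex" where
  "arc_character m n k l \<phi> = pair_character m n (rot 0 (real k * pi / real m)) (rot \<phi> (real l * pi / real n))"

definition arc_index :: "nat \<Rightarrow> nat \<Rightarrow> (nat \<times> nat) set" where
  "arc_index m n = {(k, l). k \<in> {0<..<m} \<and> l \<in> {0<..<n} \<and> even (k + l)}"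

lemma rep_pair_red: "rep_pair m n (rot 0 (real n * \<theta>)) (rot 0 (real m * \<theta>))"
  by (simp add: rep_pair_def rot_SU2 word_eval_replicate_rot mult.left_commute)

lemma rep_pair_arc:
  assumes "(k, l) \<in> arc_index m n"
  shows "rep_pair m n (rot 0 (real k * pi / real m)) (rot \<phi> (real l * pi / real n))"
proof -
  have "m > 0" "n > 0" "even k = even l"
    using assms by (auto simp: arc_index_def)
  moreover from this have "((-1) ^ k :: complex) = (-1) ^ l"
    by (simp add: minus_one_power_iff)
  ultimately show ?thesis
    by (simp add: rep_pair_def rot_SU2 word_eval_replicate_rot rot_nat_pi)
qed

lemma reducible_pair_character:
  assumes "coprime m n" "rep_pair m n A B" "common_eigenvector A B"
  obtains \<theta> where "0 \<le> \<theta>" "\<theta> \<le> pi" "pair_character m n A B = red_character m n \<theta>"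
proof -
  have S: "A \<in> carrier SU2" "B \<in> carrier SU2"
    using assms(2) by (simp_all add: rep_pair_def)
  then have det: "det A = 1" "det B = 1" by (simp_all add: SU2_det)
  obtain v c d where v: "v \<noteq> 0" "A *v v = c *s v" "B *v v = d *s v"
    using assms(3) by (auto simp: common_eigenvector_def)
  obtain \<alpha> where \<alpha>: "trace A = of_real (2 * cos \<alpha>)" using SU2_angle[OF S(1)] by blast
  obtain \<beta> where \<beta>: "trace B = of_real (2 * cos \<beta>)" using SU2_angle[OF S(2)] by blast
  obtain a where a: "c = cis a"
    using quadratic_root_cis eigenvalue_eq[OF det(1) v(1,2)] unfolding \<alpha> by blast
  obtain b where b: "d = cis b"
    using quadratic_root_cis eigenvalue_eq[OF det(2) v(1,3)] unfolding \<beta> by blast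
  have "(A ** B) *v v = (c * d) *s v"
    by (simp add: v matrix_vector_mul_assoc[symmetric] vector_scalar_commute mult.commute)
  \<comment> \<open>The eigenvalue lies on the unit circle, so the other root of the characteristic
    polynomial is its conjugate.\<close>
  moreover have tr: "trace C = e + cnj e" if "C *v v = e *s v" "e = cis x" "det C = 1" for C e x
  proof -
    have "cnj e * (e * e) = cnj e * (trace C * e - 1)"
      using eigenvalue_eq[OF that(3) v(1) that(1)] by simp
    moreover have "cnj e * e = 1"
      by (simp add: that(2) cis_cnj cis_mult)
    ultimately show ?thesis by algebra
  qed
  ultimately have trs: "trace A = cis a + cnj (cis a)" "trace B = cis b + cnj (cis b)"
    "trace (A ** B) = cis (a + b) + cnj (cis (a + b))"
    using v det tr a b by (simp_all add: det_mul cis_mult)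
  \<comment> \<open>On the common eigenvector the relation becomes an equation between eigenvalues,
    without simultaneous diagonalisation.\<close>
  have "word_eval A B (replicate k (gen_x, True)) *v v = c ^ k *s v" for k
    by (induction k) (simp_all add: matrix_vector_mul_assoc[symmetric] vector_scalar_commute v mult.commute)
  moreover have "word_eval A B (replicate k (gen_y, True)) *v v = d ^ k *s v" for k
    by (induction k) (simp_all add: matrix_vector_mul_assoc[symmetric] vector_scalar_commute v mult.commute)
  ultimately have "c ^ m *s v = d ^ n *s v"
    using assms(2) unfolding rep_pair_def by metis
  then have "c ^ m = d ^ n"
    using v(1) by (auto simp: vec_eq_iff)
  then have "cis (real m * a) = cis (real n * b)"
    by (simp add: a b Complex.DeMoivre)
  then obtain \<theta>0 where t: "cis a = cis (real n * \<theta>0)" "cis b = cis (real m * \<theta>0)"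
    using cis_common_root[OF assms(1)] by blast
  have tc: "cis x + cnj (cis x) = of_real (2 * cos x)" for x
    by (simp add: complex_eq_iff)
  have ab: "cis (a + b) = cis (real (m + n) * \<theta>0)"
    unfolding cis_mult[symmetric] t by (simp add: cis_mult algebra_simps)
  \<comment> \<open>Folds the angle into [0, pi]; the traces see it only through cosines of its
    multiples.\<close>
  define \<theta> where "\<theta> = arccos (cos \<theta>0)"
  have c\<theta>: "cos (real k * \<theta>) = cos (real k * \<theta>0)" for k
    by (rule cos_multiple_cong) (simp add: \<theta>_def)
  have "trace A = of_real (2 * cos (real n * \<theta>))" "trace B = of_real (2 * cos (real m * \<theta>))"
    "trace (A ** B) = of_real (2 * cos (real (m + n) * \<theta>))"
    unfolding trs ab unfolding t tc c\<theta> by simp_all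
  moreover have "trace (rot 0 (real n * \<theta>) ** rot 0 (real m * \<theta>)) = of_real (2 * cos (real (m + n) * \<theta>))"
    by (simp add: rot_mult trace_rot algebra_simps)
  ultimately have "pair_character m n A B = red_character m n \<theta>"
    unfolding red_character_def
    by (intro pair_character_cong rep_pair_red assms) (simp_all add: trace_rot)
  then show ?thesis
    by (intro that[of \<theta>]) (simp_all add: \<theta>_def arccos_lbound arccos_ubound)
qed

lemma sin_multiple_zero:
  assumes "0 \<le> \<alpha>" "\<alpha> \<le> pi" "sin \<alpha> \<noteq> 0" "sin (real m * \<alpha>) = 0" "m > 0"
  obtains k where "k \<in> {0<..<m}" "\<alpha> = real k * pi / real m"
proof -
  obtain i :: int where i: "real m * \<alpha> = of_int i * pi"
    using assms(4) sin_zero_iff_int2 by blast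
  have a: "0 < \<alpha>" "\<alpha> < pi"
    using assms(1-3) by (auto simp: less_le)
  have "0 < of_int i * pi" "of_int i * pi < real m * pi"
    unfolding i[symmetric] using a assms(5) by auto
  then have "0 < i" "i < int m"
    by (auto simp: zero_less_mult_iff)
  then show ?thesis
    using i assms(5) by (intro that[of "nat i"]) (auto simp: field_simps)
qed

lemma irreducible_pair_character:
  assumes "m > 0" "n > 0" "rep_pair m n A B" "\<not> common_eigenvector A B"
  obtains k l \<phi> where "(k, l) \<in> arc_index m n" "0 < \<phi>" "\<phi> < pi"
    "pair_character m n A B = arc_character m n k l \<phi>"
proof -
  have S: "A \<in> carrier SU2" "B \<in> carrier SU2"
    using assms(3) by (simp_all add: rep_pair_def)
  then have det: "det A = 1" "det B = 1" by (simp_all add: SU2_det)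
  have nc: "A ** B \<noteq> B ** A"
    using assms(4) common_eigenvector_if_commute by blast
  obtain \<alpha> where \<alpha>: "0 \<le> \<alpha>" "\<alpha> \<le> pi" "trace A = of_real (2 * cos \<alpha>)"
    using SU2_angle[OF S(1)] .
  obtain \<beta> where \<beta>: "0 \<le> \<beta>" "\<beta> \<le> pi" "trace B = of_real (2 * cos \<beta>)"
    using SU2_angle[OF S(2)] .
  obtain c where c: "-1 < c" "c < 1" "sin \<alpha> \<noteq> 0" "sin \<beta> \<noteq> 0"
    "trace (A ** B) = of_real (2 * (cos \<alpha> * cos \<beta> - sin \<alpha> * sin \<beta> * c))"
    using SU2_pair_irreducible[OF S assms(4) \<alpha>(3) \<beta>(3)] .
  define M where "M = word_eval A B (replicate m (gen_x, True))"
  have M: "M = word_eval A B (replicate n (gen_y, True))"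
    using assms(3) by (simp add: rep_pair_def M_def)
  have MA: "of_real (sin \<alpha>) * M$i$j
      = of_real (sin (m * \<alpha>)) * A$i$j - of_real (sin ((real m - 1) * \<alpha>)) * mat 1$i$j" for i j
    unfolding M_def by (rule word_eval_replicate_sin[OF det(1) \<alpha>(3)])
  have MB: "of_real (sin \<beta>) * M$i$j
      = of_real (sin (n * \<beta>)) * B$i$j - of_real (sin ((real n - 1) * \<beta>)) * mat 1$i$j" for i j
    unfolding M by (rule word_eval_replicate_sin[OF det(2) \<beta>(3)])
  \<comment> \<open>Both sides are sin \<alpha> sin \<beta> times the common power, so its two
    expressions are compared without division.\<close>
  have lin: "of_real (sin \<beta>) * (of_real (sin (m * \<alpha>)) * A$i$j - of_real (sin ((real m - 1) * \<alpha>)) * mat 1$i$j)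
     = of_real (sin \<alpha>) * (of_real (sin (n * \<beta>)) * B$i$j - of_real (sin ((real n - 1) * \<beta>)) * mat 1$i$j)" for i j
    unfolding MA[symmetric] MB[symmetric] by simp
  \<comment> \<open>If \<open>p \<noteq> 0\<close> or \<open>q \<noteq> 0\<close> below, one of the matrices is a polynomial in the other.\<close>
  define p q r :: complex where "p = of_real (sin \<beta> * sin (m * \<alpha>))" and "q = of_real (sin \<alpha> * sin (n * \<beta>))"
    and "r = of_real (sin \<beta> * sin ((real m - 1) * \<alpha>) - sin \<alpha> * sin ((real n - 1) * \<beta>))"
  have pqr: "p * A$i$j = q * B$i$j + r * mat 1$i$j" for i j
    using lin[of i j] unfolding p_def q_def r_def
    by (simp only: of_real_mult of_real_diff) algebra
  have "p = 0"
    using commute_if_linear[OF _ pqr] nc by blast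
  moreover have "q * B$i$j = p * A$i$j + (- r) * mat 1$i$j" for i j
    using pqr[of i j] by simp
  then have "q = 0"
    using commute_if_linear[of q B p A "- r"] nc by metis
  ultimately have sin0: "sin (m * \<alpha>) = 0" "sin (n * \<beta>) = 0"
    using c by (simp_all add: p_def q_def)
  obtain k where k: "k \<in> {0<..<m}" "\<alpha> = real k * pi / real m"
    using sin_multiple_zero[OF \<alpha>(1,2) c(3) sin0(1) assms(1)] .
  obtain l where l: "l \<in> {0<..<n}" "\<beta> = real l * pi / real n"
    using sin_multiple_zero[OF \<beta>(1,2) c(4) sin0(2) assms(2)] .
  have pred: "sin ((real j - 1) * x) = - cos (j * x) * sin x" if "sin (j * x) = 0" for j :: nat and x :: real
    using sin_diff[of "j * x" x] that by (simp add: algebra_simps)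
  \<comment> \<open>Once the sines vanish, the common power is the scalar cos (m \<alpha>) and also
    the scalar cos (n \<beta>). These are (-1)^k and (-1)^l, whence the parity condition.\<close>
  have "M$1$1 = of_real (cos (m * \<alpha>))" "M$1$1 = of_real (cos (n * \<beta>))"
    using MA[of 1 1] MB[of 1 1] c(3,4) unfolding pred[OF sin0(1)] pred[OF sin0(2)]
    by (simp_all add: sin0 mat_def)
  moreover have "cos (m * \<alpha>) = (-1) ^ k" "cos (n * \<beta>) = (-1) ^ l"
    using k l by simp_all
  ultimately have "(-1 :: real) ^ k = (-1) ^ l"
    by (metis of_real_eq_iff)
  then have "even (k + l)"
    by (auto simp: minus_one_power_iff split: if_splits)
  then have kl: "(k, l) \<in> arc_index m n"
    using k l by (simp add: arc_index_def)
  have "pair_character m n A B = arc_character m n k l (arccos c)"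
    unfolding arc_character_def using c \<alpha>(3) \<beta>(3)
    by (intro pair_character_cong rep_pair_arc assms kl) (simp_all add: trace_rot trace_rot_mult k(2) l(2) del: of_real_mult of_real_diff)
  moreover have "0 < arccos c" "arccos c < pi"
    using arccos_lt_bounded[OF c(1,2)] by auto
  ultimately show ?thesis
    using that kl by blast
qed

section \<open>Images and injectivity of the two parametrisations\<close>

lemma SU2_characters_red_eq:
  assumes "coprime m n"
  shows "SU2_characters_red (torus_knot_group m n) = red_character m n ` {0..pi}"
proof -
  have "common_eigenvector (rot 0 (real n * \<theta>)) (rot 0 (real m * \<theta>))" for \<theta>
    by (simp add: common_eigenvector_rot_diag)
  then have "red_character m n \<theta> \<in> SU2_characters_red (torus_knot_group m n)" for \<theta>
    unfolding SU2_characters_pairs red_character_def using rep_pair_red by blast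
  moreover have "SU2_characters_red (torus_knot_group m n) \<subseteq> red_character m n ` {0..pi}"
  proof
    fix f assume "f \<in> SU2_characters_red (torus_knot_group m n)"
    then obtain A B where AB: "rep_pair m n A B" "common_eigenvector A B" "f = pair_character m n A B"
      unfolding SU2_characters_pairs by blast
    obtain \<theta> where "0 \<le> \<theta>" "\<theta> \<le> pi" "pair_character m n A B = red_character m n \<theta>"
      using reducible_pair_character[OF assms AB(1,2)] .
    then show "f \<in> red_character m n ` {0..pi}"
      using AB(3) by simp
  qed
  ultimately show ?thesis
    by blast
qed

text \<open>A reducible pair with the same character would pass the trace identity on to the arc
  pair, although all three sines in \<open>trace_identity_rot\<close> are positive here.\<close>

lemma arc_character_not_red:
  assumes "(k, l) \<in> arc_index m n" "0 < \<phi>" "\<phi> < pi"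
  shows "arc_character m n k l \<phi> \<notin> SU2_characters_red (torus_knot_group m n)"
proof
  assume "arc_character m n k l \<phi> \<in> SU2_characters_red (torus_knot_group m n)"
  then obtain A B where AB: "rep_pair m n A B" "common_eigenvector A B"
    and eq: "pair_character m n A B = arc_character m n k l \<phi>"
    unfolding SU2_characters_pairs by force
  have "det A = 1" "det B = 1"
    using AB(1) by (simp_all add: rep_pair_def SU2_det)
  from common_eigenvector_trace_identity[OF this AB(2)]
  have "sin (real k * pi / real m) * sin (real l * pi / real n) * sin \<phi> = 0"
    unfolding pair_character_traces[OF rep_pair_arc[OF assms(1)] AB(1) eq[unfolded arc_character_def]]
    by (rule trace_identity_rot)
  moreover have "0 < sin (real k * pi / real m)" "0 < sin (real l * pi / real n)" "0 < sin \<phi>"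
    using assms by (auto intro!: sin_gt_zero simp: arc_index_def field_simps)
  ultimately show False
    by simp
qed

lemma arc_character_endpoint_red:
  assumes "(k, l) \<in> arc_index m n" "sin \<phi> = 0"
  shows "arc_character m n k l \<phi> \<in> SU2_characters_red (torus_knot_group m n)"
  unfolding SU2_characters_pairs arc_character_def
  using rep_pair_arc[OF assms(1)] common_eigenvector_rot_diag[OF assms(2)] by blast

lemma SU2_characters_irr_eq:
  assumes "m > 0" "n > 0"
  shows "SU2_characters_irr (torus_knot_group m n) = (\<Union>(k, l)\<in>arc_index m n. arc_character m n k l ` {0<..<pi})"
proof -
  \<comment> \<open>The arc pair has no common eigenvector, since otherwise its character would be
    among the reducible ones.\<close>
  have "arc_character m n k l \<phi> \<in> SU2_characters_irr (torus_knot_group m n)"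
    if "(k, l) \<in> arc_index m n" "0 < \<phi>" "\<phi> < pi" for k l \<phi>
    using arc_character_not_red[OF that] rep_pair_arc[OF that(1)]
    unfolding SU2_characters_pairs arc_character_def by blast
  moreover have "SU2_characters_irr (torus_knot_group m n) \<subseteq> (\<Union>(k, l)\<in>arc_index m n. arc_character m n k l ` {0<..<pi})"
  proof
    fix f assume "f \<in> SU2_characters_irr (torus_knot_group m n)"
    then obtain A B where AB: "rep_pair m n A B" "\<not> common_eigenvector A B" "f = pair_character m n A B"
      unfolding SU2_characters_pairs by blast
    obtain k l \<phi> where "(k, l) \<in> arc_index m n" "0 < \<phi>" "\<phi> < pi"
      "pair_character m n A B = arc_character m n k l \<phi>"
      using irreducible_pair_character[OF assms AB(1,2)] .
    then show "f \<in> (\<Union>(k, l)\<in>arc_index m n. arc_character m n k l ` {0<..<pi})"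
      using AB(3) by force
  qed
  ultimately show ?thesis
    by auto
qed

text \<open>The first two traces give the angles, because cos is injective on [0, pi]; the sines are
  then positive, so the third trace gives cos \<phi>. With the endpoints included, this one lemma
  yields disjoint arcs, embedded closed arcs and distinct endpoints.\<close>

lemma arc_character_inject:
  assumes kl: "(k, l) \<in> arc_index m n" "(k', l') \<in> arc_index m n"
    and \<phi>: "\<phi> \<in> {0..pi}" "\<phi>' \<in> {0..pi}"
    and eq: "arc_character m n k l \<phi> = arc_character m n k' l' \<phi>'"
  shows "k = k' \<and> l = l' \<and> \<phi> = \<phi>'"
proof -
  define a b a' b' where "a = real k * pi / real m" "b = real l * pi / real n"
    "a' = real k' * pi / real m" "b' = real l' * pi / real n"
  have pos: "m > 0" "n > 0"
    using kl by (auto simp: arc_index_def)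
  have range: "0 < a" "a < pi" "0 < a'" "a' < pi" "0 < b" "b < pi" "0 < b'" "b' < pi"
    using kl by (auto simp: arc_index_def a_b_a'_b'_def field_simps)
  have "trace (rot 0 a) = trace (rot 0 a')" "trace (rot \<phi> b) = trace (rot \<phi>' b')"
    "trace (rot 0 a ** rot \<phi> b) = trace (rot 0 a' ** rot \<phi>' b')"
    using pair_character_traces[OF rep_pair_arc[OF kl(2)] rep_pair_arc[OF kl(1)]] eq
    unfolding arc_character_def a_b_a'_b'_def by blast+
  then have c: "cos a = cos a'" "cos b = cos b'"
    "cos a * cos b - sin a * sin b * cos \<phi> = cos a' * cos b' - sin a' * sin b' * cos \<phi>'"
    unfolding trace_rot trace_rot_mult of_real_eq_iff by simp_all
  have ab: "a = a'" "b = b'"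
    using c(1,2) range by (auto intro: cos_inj_pi)
  have "sin a > 0" "sin b > 0"
    using range by (auto intro: sin_gt_zero)
  with c(3) have "cos \<phi> = cos \<phi>'"
    by (simp add: ab)
  then show ?thesis
    using ab \<phi> pos by (auto simp: a_b_a'_b'_def intro: cos_inj_pi)
qed

lemma red_character_inject:
  assumes "n > 0" "coprime m n" "\<theta> \<in> {0..pi}" "\<theta>' \<in> {0..pi}"
    and eq: "red_character m n \<theta> = red_character m n \<theta>'"
  shows "\<theta> = \<theta>'"
proof -
  \<comment> \<open>The word \<open>x\<^sup>a y\<^sup>-\<^sup>b\<close> generates the abelianization, so its trace recovers \<open>\<theta>\<close>.\<close>
  obtain a b where ab: "n * a = m * b + 1"
    using bezout_nat[of n m] assms(1,2) by (metis coprime_commute coprime_imp_gcd_eq_1 neq0_conv)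
  then have ab': "real n * real a = real m * real b + 1"
    by (metis of_nat_1 of_nat_add of_nat_mult)
  define w :: "xy word" where "w = replicate a (gen_x, True) @ replicate b (gen_y, False)"
  have tr: "red_character m n x (word_class (relator m n) w) = of_real (2 * cos x)" for x
  proof -
    have "word_eval (rot 0 (real n * x)) (rot 0 (real m * x)) w
        = rot 0 (real a * (real n * x) - real b * (real m * x))"
      by (simp add: w_def word_eval_append word_eval_replicate_rot rot_mult)
    also have "real a * (real n * x) - real b * (real m * x) = (real n * real a - real m * real b) * x"
      by (simp add: algebra_simps)
    also have "\<dots> = x"
      by (simp add: ab')
    finally show ?thesis
      unfolding red_character_def by (simp add: pair_character_class rep_pair_red trace_rot)
  qed
  then have "cos \<theta> = cos \<theta>'"
    using fun_cong[OF eq, of "word_class (relator m n) w"] by simp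
  then show ?thesis
    using assms by (auto intro: cos_inj_pi)
qed

lemma card_arc_index:
  assumes "coprime m n" "m > 0" "n > 0"
  shows "2 * card (arc_index m n) = (m - 1) * (n - 1)"
proof -
  let ?S = "{0<..<m} \<times> {0<..<n}"
  let ?J = "arc_index m n"
  have J: "?J \<subseteq> ?S" "finite ?S"
    by (auto simp: arc_index_def)
  have "card (?S - ?J) = card ?J"
  proof -
    \<comment> \<open>Reflecting the coordinate with odd modulus exchanges the two parity classes.\<close>
    consider "odd m" | "odd n"
      using assms(1) by (metis coprime_common_divisor_nat odd_one one_dvd dvd_refl coprime_def)
    then show ?thesis
    proof cases
      case 1
      have "bij_betw (\<lambda>(k, l). (m - k, l)) ?J (?S - ?J)"
        by (rule bij_betwI[of _ _ _ "\<lambda>(k, l). (m - k, l)"]) (use 1 in \<open>auto simp: arc_index_def\<close>)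
      then show ?thesis by (metis bij_betw_same_card)
    next
      case 2
      have "bij_betw (\<lambda>(k, l). (k, n - l)) ?J (?S - ?J)"
        by (rule bij_betwI[of _ _ _ "\<lambda>(k, l). (k, n - l)"]) (use 2 in \<open>auto simp: arc_index_def\<close>)
      then show ?thesis by (metis bij_betw_same_card)
    qed
  qed
  moreover have "card (?S - ?J) = card ?S - card ?J"
    using J by (simp add: card_Diff_subset finite_subset)
  moreover have "card ?J \<le> card ?S"
    by (rule card_mono[OF J(2,1)])
  moreover have "card ?S = (m - 1) * (n - 1)"
    by (simp add: card_cartesian_product)
  ultimately show ?thesis
    by linarith
qed

section \<open>Topology\<close>

lemma continuous_rot:
  fixes f g :: "real \<Rightarrow> real"
  assumes "continuous_on S f" "continuous_on S g"
  shows "continuous_on S (\<lambda>t. rot (f t) (g t) $ i $ j)"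
  using exhaust_2[of i] exhaust_2[of j]
  by (elim disjE; simp add: rot_entries Complex_eq; intro continuous_intros assms)

lemma continuous_map_pair_character:
  fixes A B :: "real \<Rightarrow> complex^2^2"
  assumes "\<And>i j. continuous_on S (\<lambda>t. A t $ i $ j)" "\<And>i j. continuous_on S (\<lambda>t. B t $ i $ j)"
  shows "continuous_map (top_of_set S)
     (product_topology (\<lambda>_. euclidean) (carrier (torus_knot_group m n)))
     (\<lambda>t. pair_character m n (A t) (B t))"
  unfolding continuous_map_componentwise
proof (intro conjI ballI)
  \<comment> \<open>Points of the product space are \<open>undefined\<close> off the carrier, which
    the restriction in \<open>rep_character\<close> provides.\<close>
  show "(\<lambda>t. pair_character m n (A t) (B t)) ` topspace (top_of_set S) \<subseteq> extensional (carrier (torus_knot_group m n))"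
    by (auto simp: pair_character_def rep_character_def)
next
  \<comment> \<open>The word chosen to represent \<open>g\<close> does not depend on
    \<open>t\<close>, so the value is the trace of one fixed word in continuous matrices.\<close>
  fix g assume "g \<in> carrier (torus_knot_group m n)"
  then show "continuous_map (top_of_set S) euclidean (\<lambda>t. pair_character m n (A t) (B t) g)"
    by (simp add: pair_character_def rep_character_def rep_of_pair_def trace_2 continuous_on_add
        continuous_word_eval assms)
qed

lemma continuous_red_character:
  "continuous_map (top_of_set S) (product_topology (\<lambda>_. euclidean) (carrier (torus_knot_group m n)))
     (red_character m n)"
proof -
  have "continuous_on S (\<lambda>t. rot 0 (c * t) $ i $ j)" for c i j
    by (intro continuous_rot continuous_intros)
  then have "continuous_map (top_of_set S) (product_topology (\<lambda>_. euclidean) (carrier (torus_knot_group m n)))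
     (\<lambda>\<theta>. pair_character m n (rot 0 (real n * \<theta>)) (rot 0 (real m * \<theta>)))"
    by (intro continuous_map_pair_character)
  then show ?thesis
    by (simp add: red_character_def[abs_def])
qed

lemma continuous_arc_character:
  "continuous_map (top_of_set S) (product_topology (\<lambda>_. euclidean) (carrier (torus_knot_group m n)))
     (arc_character m n k l)"
proof -
  have "continuous_on S (\<lambda>t. rot t c $ i $ j)" for c i j
    by (intro continuous_rot continuous_intros)
  then have "continuous_map (top_of_set S) (product_topology (\<lambda>_. euclidean) (carrier (torus_knot_group m n)))
     (\<lambda>\<phi>. pair_character m n (rot 0 (real k * pi / real m)) (rot \<phi> (real l * pi / real n)))"
    by (intro continuous_map_pair_character) simp_all
  then show ?thesis
    by (simp add: arc_character_def[abs_def])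
qed

text \<open>A continuous injection of a compact space into a Hausdorff space is a homeomorphism onto
  its image; the factor \<open>c\<close> passes from the natural angle range to the unit
  interval.\<close>

lemma homeomorphic_map_scaled_interval:
  fixes f :: "real \<Rightarrow> 'a"
  assumes "continuous_map (top_of_set {0..c}) X f" "inj_on f {0..c}" "Hausdorff_space X" "c > 0"
  shows "homeomorphic_map (top_of_set {0..1}) (subtopology X (f ` {0..c})) (\<lambda>t. f (c * t))"
proof (rule continuous_imp_homeomorphic_map)
  have *: "(\<lambda>t. c * t) ` {0..1} = {0..c}"
    using assms(4) by (simp add: image_mult_atLeastAtMost_if)
  have sub: "f ` {0..c} \<subseteq> topspace X"
    using continuous_map_image_subset_topspace[OF assms(1)] by simp
  have im: "(\<lambda>t. f (c * t)) ` {0..1} = f ` {0..c}"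
    using * by (metis image_image)
  have "continuous_map (top_of_set {0..1}) (top_of_set {0..c}) (\<lambda>t. c * t)"
    using assms(4) by (auto intro!: continuous_intros simp: mult_left_le)
  from continuous_map_compose[OF this assms(1)]
  show "continuous_map (top_of_set {0..1}) (subtopology X (f ` {0..c})) (\<lambda>t. f (c * t))"
    using im by (auto simp: continuous_map_in_subtopology o_def)
  show "(\<lambda>t. f (c * t)) ` topspace (top_of_set {0..1}) = topspace (subtopology X (f ` {0..c}))"
    using im sub by auto
  show "inj_on (\<lambda>t. f (c * t)) (topspace (top_of_set {0..1}))"
    using assms(4) by (auto simp: inj_on_def mult_left_le dest!: inj_onD[OF assms(2)])
qed (use assms in \<open>auto simp: compact_space_subtopology Hausdorff_space_subtopology\<close>)

text \<open>The image of the closed interval is compact, hence closed, and the open interval is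
  dense in the closed one.\<close>

lemma closure_of_image_interval:
  fixes f :: "real \<Rightarrow> 'a"
  assumes "continuous_map (top_of_set {0..c}) X f" "Hausdorff_space X" "c > 0"
  shows "X closure_of f ` {0<..<c} = f ` {0..c}" "closedin X (f ` {0..c})"
proof -
  have "compactin X (f ` {0..c})"
    by (rule image_compactin[OF _ assms(1)]) (simp add: compactin_subtopology)
  then show closed: "closedin X (f ` {0..c})"
    by (rule compactin_imp_closedin[OF assms(2)])
  have "X closure_of f ` {0<..<c} \<subseteq> f ` {0..c}"
    by (rule closure_of_minimal[OF _ closed]) auto
  moreover have "top_of_set {0..c} closure_of {0<..<c} = {0..c}"
    using assms(3) by (simp add: closure_of_subtopology Int_absorb1 greaterThanLessThan_subseteq_atLeastAtMost_iff)
  then have "f ` {0..c} \<subseteq> X closure_of f ` {0<..<c}"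
    using continuous_map_image_closure_subset[OF assms(1), of "{0<..<c}"] by simp
  ultimately show "X closure_of f ` {0<..<c} = f ` {0..c}" ..
qed

lemma SU2_characters_subset_variety: "SU2_characters G \<subseteq> SL2_character_variety G"
  by (auto simp: SU2_characters_def SL2_character_variety_def SU2_def SL2_def hom_def)

text \<open>Reduces the nested subspaces to the plain product topology, where the Hausdorff and
  compactness arguments live.\<close>

lemma subtopology_character_topology:
  assumes "S \<subseteq> SU2_characters G"
  shows "subtopology (subtopology (character_topology G) (SU2_characters G)) S
     = subtopology (product_topology (\<lambda>_. euclidean) (carrier G)) S"
  using assms SU2_characters_subset_variety[of G]
  by (simp add: character_topology_def subtopology_subtopology Int_absorb1 subset_trans)

lemma SU2_characters_extensional:
  "SU2_characters G \<subseteq> topspace (product_topology (\<lambda>_. euclidean) (carrier G))"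
  by (auto simp: SU2_characters_def rep_character_def)

theorem mainTheorem3:
  fixes m n :: nat
  assumes "m > 0" and "n > 0" and "coprime m n"
  shows
    "let G = torus_knot_group m n;
         Y = SU2_characters G;
         Y_red = SU2_characters_red G;
         Y_irr = SU2_characters_irr G;
         T = subtopology (character_topology G) Y
     in topspace T = Y \<and>
        Y = Y_red \<union> Y_irr \<and> Y_red \<inter> Y_irr = {} \<and>
        subtopology T Y_red homeomorphic_space top_of_set {0..1::real} \<and>
        (\<exists>(\<I> :: (xy word set \<Rightarrow> complex) set set) p q.
           finite \<I> \<and> real (card \<I>) = (real m - 1) * (real n - 1) / 2 \<and>
           \<Union>\<I> = Y_irr \<and> pairwise disjnt \<I> \<and>
           (\<forall>I\<in>\<I>.
              openin (subtopology T Y_irr) I \<and>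
              subtopology T I homeomorphic_space top_of_set {0<..<1::real} \<and>
              p I \<in> Y_red \<and> q I \<in> Y_red \<and> p I \<noteq> q I \<and>
              T closure_of I = I \<union> {p I, q I} \<and>
              (\<exists>h. homeomorphic_map (top_of_set {0..1::real}) (subtopology T (T closure_of I)) h \<and>
                   h ` {0<..<1} = I \<and> h 0 = p I \<and> h 1 = q I)) \<and>
           card (p ` \<I> \<union> q ` \<I>) = (m - 1) * (n - 1))"
proof -
  define G where "G = torus_knot_group m n"
  define Y where "Y = SU2_characters G"
  define Yr where "Yr = SU2_characters_red G"
  define Yi where "Yi = SU2_characters_irr G"
  define P :: "(xy word set \<Rightarrow> complex) topology" where "P = product_topology (\<lambda>_. euclidean) (carrier G)"
  define T where "T = subtopology (character_topology G) Y"
  define J where "J = arc_index m n"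
  define arc where "arc j = arc_character m n (fst j) (snd j)" for j
  define F where "F j = arc j ` {0<..<pi}" for j
  define \<I> where "\<I> = F ` J"
  \<comment> \<open>The endpoint functions take the arc as a set, so its index has to be recovered
    from the set; \<open>inj_F\<close> below justifies this.\<close>
  define idx where "idx = the_inv_into J F"
  define p q where "p I = arc (idx I) 0" and "q I = arc (idx I) pi" for I

  have H: "Hausdorff_space P"
    by (simp add: P_def Hausdorff_space_product_topology)
  have T_sub: "subtopology T S = subtopology P S" if "S \<subseteq> Y" for S
    unfolding T_def P_def Y_def using that by (intro subtopology_character_topology) (simp add: Y_def)
  have T: "T = subtopology P Y"
    using T_sub[of Y] by (simp add: T_def subtopology_subtopology)
  have YP: "Y \<subseteq> topspace P"
    unfolding Y_def P_def by (rule SU2_characters_extensional)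
  have Y: "Y = Yr \<union> Yi"
    by (auto simp: Y_def Yr_def Yi_def SU2_characters_def SU2_characters_red_def SU2_characters_irr_def)
  have Yi: "Yi = \<Union> (F ` J)"
    unfolding Yi_def G_def SU2_characters_irr_eq[OF assms(1,2)]
    by (auto simp: F_def J_def arc_def case_prod_unfold)
  have not_red: "arc j \<phi> \<notin> Yr" if "j \<in> J" "0 < \<phi>" "\<phi> < pi" for j \<phi>
    using that arc_character_not_red[of "fst j" "snd j"] by (simp add: arc_def J_def Yr_def G_def)
  have disj: "Yr \<inter> Yi = {}"
    using not_red by (auto simp: Yi F_def)
  have ends: "arc j 0 \<in> Yr" "arc j pi \<in> Yr" if "j \<in> J" for j
    using that arc_character_endpoint_red[of "fst j" "snd j"] by (simp_all add: arc_def J_def Yr_def G_def)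
  have inj: "j = j' \<and> \<phi> = \<phi>'"
    if "arc j \<phi> = arc j' \<phi>'" "j \<in> J" "j' \<in> J" "\<phi> \<in> {0..pi}" "\<phi>' \<in> {0..pi}" for j j' \<phi> \<phi>'
    using arc_character_inject[of "fst j" "snd j" m n "fst j'" "snd j'" \<phi> \<phi>'] that
    by (simp add: arc_def J_def prod_eq_iff)
  have cont: "continuous_map (top_of_set {0..pi}) P (arc j)" for j
    unfolding P_def G_def arc_def by (rule continuous_arc_character)
  have C: "arc j ` {0..pi} = F j \<union> {arc j 0, arc j pi}" for j
  proof -
    have "{0..pi} = {0<..<pi} \<union> {0, pi}" by auto
    then show ?thesis unfolding F_def by (metis image_Un image_empty image_insert)
  qed
  have CY: "arc j ` {0..pi} \<subseteq> Y" "F j \<subseteq> Y" if "j \<in> J" for j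
    using that ends[OF that] by (auto simp: C Y Yi)
  have inj_F: "inj_on F J"
  proof (rule inj_onI)
    fix j j' assume j: "j \<in> J" "j' \<in> J" "F j = F j'"
    \<comment> \<open>The midpoint serves as a point of the nonempty set \<open>F j\<close>; a
      common point already forces equal indices.\<close>
    have mid: "pi / 2 \<in> {0<..<pi}" by simp
    then have "arc j (pi / 2) \<in> F j'"
      unfolding j(3)[symmetric] unfolding F_def by (rule imageI)
    then obtain \<phi> where "arc j (pi / 2) = arc j' \<phi>" "\<phi> \<in> {0<..<pi}"
      unfolding F_def by (rule imageE)
    then show "j = j'"
      using inj[of j "pi / 2" j' \<phi>] j(1,2) by simp
  qed
  have idx: "idx (F j) = j" if "j \<in> J" for j
    unfolding idx_def using inj_F that by (rule the_inv_into_f_f)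
  have "J \<subseteq> {..<m} \<times> {..<n}"
    by (auto simp: J_def arc_index_def)
  then have fin: "finite J"
    by (rule finite_subset) simp
  have card_J: "2 * card J = (m - 1) * (n - 1)"
    unfolding J_def by (rule card_arc_index[OF assms(3,1,2)])
  have dF: "disjnt (F j) (F j')" if "j \<in> J" "j' \<in> J" "j \<noteq> j'" for j j'
    unfolding F_def disjnt_def
  proof (rule equals0I)
    fix f assume "f \<in> arc j ` {0<..<pi} \<inter> arc j' ` {0<..<pi}"
    then obtain \<phi> \<phi>' where "\<phi> \<in> {0<..<pi}" "\<phi>' \<in> {0<..<pi}" "arc j \<phi> = arc j' \<phi>'"
      by (metis IntE imageE)
    then show False
      using inj[of j \<phi> j' \<phi>'] that by simp
  qed

  have Yr_interval: "subtopology T Yr homeomorphic_space top_of_set {0..1::real}"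
  proof -
    have "Yr = red_character m n ` {0..pi}"
      unfolding Yr_def G_def by (rule SU2_characters_red_eq[OF assms(3)])
    moreover have "homeomorphic_map (top_of_set {0..1}) (subtopology P (red_character m n ` {0..pi}))
        (\<lambda>t. red_character m n (pi * t))"
      using H red_character_inject[OF assms(2,3)]
      by (intro homeomorphic_map_scaled_interval) (auto simp: P_def G_def continuous_red_character inj_on_def)
    ultimately have "top_of_set {0..1::real} homeomorphic_space subtopology P Yr"
      using homeomorphic_map_imp_homeomorphic_space by metis
    moreover have "subtopology T Yr = subtopology P Yr"
      by (rule T_sub) (simp add: Y)
    ultimately show ?thesis
      using homeomorphic_space_sym by metis
  qed

  have arc_props: "openin (subtopology T Yi) (F j) \<and>
      subtopology T (F j) homeomorphic_space top_of_set {0<..<1::real} \<and>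
      T closure_of F j = F j \<union> {arc j 0, arc j pi} \<and>
      (\<exists>h. homeomorphic_map (top_of_set {0..1::real}) (subtopology T (T closure_of F j)) h \<and>
         h ` {0<..<1} = F j \<and> h 0 = arc j 0 \<and> h 1 = arc j pi)" if j: "j \<in> J" for j
  proof (intro conjI exI)
    \<comment> \<open>A closed arc is closed in the whole space and meets \<open>Yi\<close> only in
      its open part, since its endpoints are reducible.\<close>
    have closed: "closedin (subtopology P Yi) (F i)" if "i \<in> J" for i
    proof -
      have "closedin P (arc i ` {0..pi})"
        using closure_of_image_interval(2)[OF cont H] by simp
      moreover have "Yi \<inter> arc i ` {0..pi} = F i"
        using that ends[OF that] disj by (auto simp: C Yi)
      ultimately show ?thesis
        by (metis closedin_subtopology_Int_closed)
    qed
    \<comment> \<open>The complement of \<open>F j\<close> in \<open>Yi\<close> is a finite union of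
      closed sets.\<close>
    have "closedin (subtopology P Yi) (\<Union> (F ` (J - {j})))"
      using fin closed by (intro closedin_Union) auto
    moreover have "Yi - \<Union> (F ` (J - {j})) = F j"
      using j dF unfolding Yi disjnt_iff by blast
    moreover have "topspace (subtopology P Yi) = Yi"
      using YP Y by auto
    ultimately show "openin (subtopology T Yi) (F j)"
      using T_sub[of Yi] Y by (metis closedin_def sup_ge2)
    show clos: "T closure_of F j = F j \<union> {arc j 0, arc j pi}"
      using closure_of_image_interval(1)[OF cont[of j] H] CY[OF j]
      by (simp add: T closure_of_subtopology Int_absorb1 C flip: F_def)
    have "homeomorphic_map (top_of_set {0..1}) (subtopology P (arc j ` {0..pi})) (\<lambda>t. arc j (pi * t))"
      using H cont inj j by (intro homeomorphic_map_scaled_interval) (auto simp: inj_on_def)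
    then show hom: "homeomorphic_map (top_of_set {0..1}) (subtopology T (T closure_of F j)) (\<lambda>t. arc j (pi * t))"
      using T_sub[OF CY(1)[OF j]] by (simp add: clos C)
    have "(\<lambda>t. pi * t) ` {0<..<1} = {0<..<pi}"
    proof
      show "{0<..<pi} \<subseteq> (\<lambda>t. pi * t) ` {0<..<1}"
        by (auto intro!: image_eqI[of _ _ "x / pi" for x])
    qed auto
    then show im: "(\<lambda>t. arc j (pi * t)) ` {0<..<1} = F j"
      unfolding F_def by (metis image_image)
    \<comment> \<open>The parametrisation of the open arc is the restriction of that of the closed
      arc.\<close>
    have "homeomorphic_map (subtopology (top_of_set {0..1}) {0<..<1})
        (subtopology (subtopology T (T closure_of F j)) (F j)) (\<lambda>t. arc j (pi * t))"
    proof (rule homeomorphic_map_subtopologies[OF hom])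
      have "topspace T = Y"
        using YP by (auto simp: T)
      then have "topspace (subtopology T (T closure_of F j)) \<inter> F j = F j"
        using CY[OF j] by (auto simp: clos)
      moreover have "topspace (top_of_set {0..1::real}) \<inter> {0<..<1} = {0<..<1}"
        by auto
      ultimately show "(\<lambda>t. arc j (pi * t)) ` (topspace (top_of_set {0..1}) \<inter> {0<..<1})
          = topspace (subtopology T (T closure_of F j)) \<inter> F j"
        using im by simp
    qed
    moreover have "subtopology (subtopology T (T closure_of F j)) (F j) = subtopology T (F j)"
      unfolding subtopology_subtopology clos by (intro arg_cong[where f="subtopology T"]) blast
    moreover have "subtopology (top_of_set {0..1::real}) {0<..<1} = top_of_set {0<..<1}"
      by (simp add: subtopology_subtopology Int_absorb1 greaterThanLessThan_subseteq_atLeastAtMost_iff)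
    ultimately show "subtopology T (F j) homeomorphic_space top_of_set {0<..<1::real}"
      using homeomorphic_map_imp_homeomorphic_space homeomorphic_space_sym by metis
  qed simp_all

  have "card (p ` \<I> \<union> q ` \<I>) = card ((\<lambda>j. arc j 0) ` J \<union> (\<lambda>j. arc j pi) ` J)"
    by (simp add: \<I>_def image_image p_def q_def idx cong: image_cong)
  \<comment> \<open>A start point never equals an end point, as \<open>inj\<close> would identify
    the parameters 0 and pi.\<close>
  also have "\<dots> = card ((\<lambda>j. arc j 0) ` J) + card ((\<lambda>j. arc j pi) ` J)"
    using fin inj[of _ 0 _ pi] by (intro card_Un_disjoint) auto
  also have "\<dots> = 2 * card J"
    using inj[of _ 0 _ 0] inj[of _ pi _ pi] by (simp add: card_image inj_on_def)
  finally have card_ends: "card (p ` \<I> \<union> q ` \<I>) = (m - 1) * (n - 1)"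
    by (simp add: card_J)
  have "card \<I> = card J"
    unfolding \<I>_def by (rule card_image[OF inj_F])
  \<comment> \<open>Subtraction on the naturals is truncated; positivity of \<open>m\<close> and
    \<open>n\<close> lets it pass to the reals.\<close>
  moreover have "2 * real (card J) = (real m - 1) * (real n - 1)"
    using arg_cong[OF card_J, of real] assms(1,2) by (simp add: of_nat_diff Suc_le_eq)
  ultimately have card_\<I>: "real (card \<I>) = (real m - 1) * (real n - 1) / 2"
    by simp
  have each: "\<forall>I\<in>\<I>. openin (subtopology T Yi) I \<and>
      subtopology T I homeomorphic_space top_of_set {0<..<1::real} \<and>
      p I \<in> Yr \<and> q I \<in> Yr \<and> p I \<noteq> q I \<and>
      T closure_of I = I \<union> {p I, q I} \<and>
      (\<exists>h. homeomorphic_map (top_of_set {0..1::real}) (subtopology T (T closure_of I)) h \<and>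
         h ` {0<..<1} = I \<and> h 0 = p I \<and> h 1 = q I)" (is "\<forall>I\<in>\<I>. ?Q I")
  proof
    fix I assume I: "I \<in> \<I>"
    obtain j where j: "j \<in> J" "I = F j"
      using I unfolding \<I>_def by blast
    then have pq: "p I = arc j 0" "q I = arc j pi"
      by (simp_all add: p_def q_def idx)
    have "arc j 0 \<noteq> arc j pi"
      using inj[of j 0 j pi] j by auto
    then show "?Q I"
      unfolding pq unfolding j(2) using arc_props[OF j(1)] ends[OF j(1)] by blast
  qed
  have "finite \<I>" "\<Union>\<I> = Yi" "pairwise disjnt \<I>"
    using fin dF by (auto simp: \<I>_def Yi pairwise_def)
  have "topspace T = Y"
    using YP by (auto simp: T)
  show ?thesis
    unfolding Let_def G_def[symmetric] Y_def[symmetric] Yr_def[symmetric] Yi_def[symmetric] T_def[symmetric]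
  proof (intro conjI)
    show "topspace T = Y" "Y = Yr \<union> Yi" "Yr \<inter> Yi = {}" "subtopology T Yr homeomorphic_space top_of_set {0..1::real}"
      by fact+
  qed (rule exI[of _ \<I>], rule exI[of _ p], rule exI[of _ q], (intro conjI; fact))
qed

end
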